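(* Let $v$ be a weight on $\mathbb{C}$ and let $J=(m_n)_{n=0}^\infty$ be a strictly increasing, unbounded sequence of positive integers such that for some $b>2$ and $K\ge b$ we have, for each $n$, $$b\le \min\big(A(m_n,m_{n+1}),B(m_n,m_{n+1})\big)\le \max\big(A(m_n,m_{n+1}),B(m_n,m_{n+1})\big)\le K .$$ Let $1\le p\le\infty$. Then a complex sequence $(\lambda_m)_{m=0}^\infty$ is a multiplier from $H_v^\infty(\mathbb{C})$ into $\ell_p$ if and only if the sequence $(\mu_m)_{m>m_0}$ defined by $$\mu_m:=\big(v(r_{m_n})\,r_{m_n}^m\big)^{-1}|\lambda_m|\qquad (m_n<m\le m_{n+1},\ n=0,1,2,\dots)$$ belongs to $\ell^J(r,s)$, where (a) $r=2p/(2-p)$ and $s=p$, if $1\le p<2$; (b) $r=\infty$ and $s=p$, if $2\le p<\infty$; (c) $r=s=\infty$, if $p=\infty$.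
   Context: A weight $v$ is a continuous function $v:[0,\infty)\to(0,\infty)$ which is non-increasing on $[0,\infty)$ and rapidly decreasing, i.e. $\lim_{r\to\infty}r^m v(r)=0$ for each $m\in\mathbb{N}=\{1,2,\dots\}$; it is extended to $\mathbb{C}$ by $v(z):=v(|z|)$. $H_v^\infty(\mathbb{C})$ is the Banach space of entire functions $f$ with $\sup_{z\in\mathbb{C}}v(z)|f(z)|<\infty$; an entire function $f(z)=\sum_{m=0}^\infty a_mz^m$ is identified with its sequence of Taylor coefficients $(a_m)_{m=0}^\infty$. A sequence $(\lambda_m)_{m\ge 0}$ is a multiplier from a sequence space $X$ into a sequence space $Y$ if $(\lambda_ma_m)_m\in Y$ for every $(a_m)_m\in X$. For real $m>0$, $r_m$ denotes a (fixed) global maximum point of $r\mapsto r^m v(r)$ on $[0,\infty)$. For $0<m<n$, $$A(m,n):=\Big(\frac{r_m}{r_n}\Big)^m\frac{v(r_m)}{v(r_n)},\qquad B(m,n):=\Big(\frac{r_n}{r_m}\Big)^n\frac{v(r_n)}{v(r_m)} .$$ For $1\le r,s\le\infty$, a sequence $(\mu_m)$ belongs to $\ell^J(r,s)$ if the sequence $\Big(\big(\sum_{m=m_n+1}^{m_{n+1}}|\mu_m|^r\big)^{1/r}\Big)_{n=0}^\infty$ belongs to $\ell_s$, where for $r=\infty$ the inner expression is $\max_{m_n<m\le m_{n+1}}|\mu_m|$. (No condition is imposed on the finitely many indices $m\le m_0$.) *)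

theory Defs
  imports "HOL-Analysis.Analysis"
begin

text \<open>Only the values of v on the nonnegative reals matter; the extension of v to the
  complex plane is \<open>\<lambda>z. v (cmod z)\<close>.\<close>

definition weight :: "(real \<Rightarrow> real) \<Rightarrow> bool" where
  "weight v \<longleftrightarrow>
     continuous_on {0..} v \<and>
     (\<forall>r\<ge>0. 0 < v r) \<and>
     antimono_on {0..} v \<and>
     (\<forall>m::nat. 1 \<le> m \<longrightarrow> ((\<lambda>r. r ^ m * v r) \<longlongrightarrow> 0) at_top)"

definition H_inf :: "(real \<Rightarrow> real) \<Rightarrow> (complex \<Rightarrow> complex) set" where
  "H_inf v = {f. f holomorphic_on UNIV \<and> bdd_above (range (\<lambda>z. v (cmod z) * cmod (f z)))}"

text \<open>The space \<open>H_inf v\<close> seen as a sequence space, via Taylor coefficients at the origin.\<close>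

definition H_inf_seq :: "(real \<Rightarrow> real) \<Rightarrow> (nat \<Rightarrow> complex) set" where
  "H_inf_seq v = {a. \<exists>f\<in>H_inf v. \<forall>z. (\<lambda>m. a m * z ^ m) sums f z}"

text \<open>The exponents of sequence spaces are extended reals in \<open>{1..\<infinity>}\<close>.\<close>

definition ell :: "ereal \<Rightarrow> (nat \<Rightarrow> 'a::real_normed_vector) set" where
  "ell p = {a. if p = \<infinity> then bounded (range a)
               else summable (\<lambda>m. norm (a m) powr real_of_ereal p)}"

definition multiplier ::
  "(nat \<Rightarrow> complex) \<Rightarrow> (nat \<Rightarrow> complex) set \<Rightarrow> (nat \<Rightarrow> complex) set \<Rightarrow> bool" where
  "multiplier lam X Y \<longleftrightarrow> (\<forall>a\<in>X. (\<lambda>m. lam m * a m) \<in> Y)"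

text \<open>\<open>max_points v \<rho>\<close>: for every real \<open>m > 0\<close>, the number \<open>\<rho> m\<close> is a global maximum point of
  \<open>r \<mapsto> r\<^sup>m v(r)\<close> on \<open>{0..}\<close>. Such a point need not be unique; \<open>\<rho>\<close> is a choice of one for each \<open>m\<close>.
  Note that \<open>0 powr m = 0\<close>.\<close>

definition max_points :: "(real \<Rightarrow> real) \<Rightarrow> (real \<Rightarrow> real) \<Rightarrow> bool" where
  "max_points v \<rho> \<longleftrightarrow>
     (\<forall>m>0. 0 \<le> \<rho> m \<and> (\<forall>r\<ge>0. r powr m * v r \<le> \<rho> m powr m * v (\<rho> m)))"

definition A :: "(real \<Rightarrow> real) \<Rightarrow> (real \<Rightarrow> real) \<Rightarrow> real \<Rightarrow> real \<Rightarrow> real" where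
  "A v \<rho> m n = (\<rho> m / \<rho> n) powr m * (v (\<rho> m) / v (\<rho> n))"

definition B :: "(real \<Rightarrow> real) \<Rightarrow> (real \<Rightarrow> real) \<Rightarrow> real \<Rightarrow> real \<Rightarrow> real" where
  "B v \<rho> m n = (\<rho> n / \<rho> m) powr n * (v (\<rho> n) / v (\<rho> m))"

definition block_norm :: "(nat \<Rightarrow> nat) \<Rightarrow> ereal \<Rightarrow> (nat \<Rightarrow> real) \<Rightarrow> nat \<Rightarrow> real" where
  "block_norm J r \<mu> n =
     (if r = \<infinity> then Max ((\<lambda>m. \<bar>\<mu> m\<bar>) ` {J n<..J (Suc n)})
      else (\<Sum>m\<in>{J n<..J (Suc n)}. \<bar>\<mu> m\<bar> powr real_of_ereal r) powr (1 / real_of_ereal r))"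

definition ell_J :: "(nat \<Rightarrow> nat) \<Rightarrow> ereal \<Rightarrow> ereal \<Rightarrow> (nat \<Rightarrow> real) set" where
  "ell_J J r s = {\<mu>. block_norm J r \<mu> \<in> ell s}"

text \<open>For strictly increasing \<open>J\<close> and \<open>m > J 0\<close>, the index \<open>block_index J m\<close> is unique. The values
  at \<open>m \<le> J 0\<close> are irrelevant, since \<open>ell_J\<close> does not depend on them.\<close>

definition block_index :: "(nat \<Rightarrow> nat) \<Rightarrow> nat \<Rightarrow> nat" where
  "block_index J m = (THE n. J n < m \<and> m \<le> J (Suc n))"

definition weighted_coeffs ::
  "(real \<Rightarrow> real) \<Rightarrow> (real \<Rightarrow> real) \<Rightarrow> (nat \<Rightarrow> nat) \<Rightarrow> (nat \<Rightarrow> complex) \<Rightarrow> nat \<Rightarrow> real" where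
  "weighted_coeffs v \<rho> J lam m =
     (let R = \<rho> (real (J (block_index J m))) in inverse (v R * R ^ m) * cmod (lam m))"

end

theory Submission
  imports Defs "HOL-Complex_Analysis.Complex_Analysis"
begin

text \<open>Put \<open>R\<^sub>n = \<rho> (J n)\<close>. Parseval on the circle \<open>|z| = R\<^sub>n\<close> bounds \<open>\<Sum> (v(R\<^sub>n) R\<^sub>n\<^sup>m |a\<^sub>m|)\<^sup>2\<close>
  over the \<open>n\<close>-th block for every \<open>f = \<Sum> a\<^sub>m z\<^sup>m\<close> in \<open>H_inf v\<close>, and Hoelder's inequality on each block
  gives sufficiency. Conversely, if \<open>f\<^sub>n\<close> are polynomials with frequencies in the \<open>n\<close>-th block and
  \<open>|f\<^sub>n| \<le> 1\<close> on the unit circle, then \<open>\<Sum> f\<^sub>n(z / R\<^sub>n) / v(R\<^sub>n)\<close> lies in \<open>H_inf v\<close>: the conditions on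
  \<open>A\<close> and \<open>B\<close> and the maximum principle make the contributions of distant blocks decay geometrically.
  Testing a multiplier on this single function gives necessity, once each \<open>f\<^sub>n\<close> is chosen with
  sufficiently large coefficients. For \<open>p \<ge> 2\<close> monomials suffice. For \<open>p < 2\<close> one uses a Kislyakov type
  theorem: for all \<open>lam\<^sub>i\<close> some \<open>f\<^sub>n\<close> satisfies \<open>\<Sum> |lam\<^sub>i| |coeff\<^sub>i f\<^sub>n| \<ge> c (\<Sum> |lam\<^sub>i|\<^sup>2)\<^sup>1\<^sup>/\<^sup>2\<close>.\<close>

subsection \<open>Averages over roots of unity\<close>

text \<open>Sampling at the \<open>N\<close>-th roots of unity replaces integration over the unit
  circle: for polynomials of degree below \<open>N\<close> the resulting orthogonality relations are
  exact, so only finite sums occur.\<close>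

definition uroot :: "nat \<Rightarrow> nat \<Rightarrow> complex" where
  "uroot N k = cis (2 * pi * real k / real N)"

lemma norm_uroot [simp]: "norm (uroot N k) = 1"
  by (simp add: uroot_def)

lemma norm_uroot_power [simp]: "norm (uroot N k ^ m) = 1"
  by (simp add: norm_power)

text \<open>For each \<open>j\<close> this is a geometric sum with ratio \<omega>, an
  \<open>N\<close>-th root of unity. Integer exponents are allowed because Parseval produces
  differences of two exponents.\<close>

lemma sum_uroot_powi:
  assumes "0 < N"
  shows "(\<Sum>k<N. uroot N k powi j) = (if int N dvd j then of_nat N else 0)"
proof -
  define \<omega> where "\<omega> = cis (2 * pi * of_int j / real N)"
  have pw: "uroot N k powi j = \<omega> ^ k" for k
    unfolding uroot_def \<omega>_def cis_power_int Complex.DeMoivre by (rule arg_cong[of _ _ cis]) (simp add: field_simps)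
  have \<omega>N: "\<omega> ^ N = 1"
  proof -
    have "\<omega> ^ N = cis (2 * pi * of_int j)"
      unfolding \<omega>_def Complex.DeMoivre using assms by simp
    also have "\<dots> = 1"
      by (rule cis_multiple_2pi) auto
    finally show ?thesis .
  qed
  have iff: "\<omega> = 1 \<longleftrightarrow> int N dvd j"
  proof
    assume "\<omega> = 1"
    then have "cos (2 * pi * of_int j / real N) = 1"
      by (simp add: \<omega>_def complex_eq_iff)
    then obtain n :: int where "2 * pi * of_int j / real N = of_int n * (2 * pi)"
      by (auto simp: cos_one_2pi_int mult_ac)
    then have "of_int j = (of_int (n * int N) :: real)"
      using assms by (simp add: field_simps)
    then have "j = n * int N"
      by (simp only: of_int_eq_iff)
    then show "int N dvd j" by simp
  next
    assume "int N dvd j"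
    then obtain n where "j = int N * n" ..
    then have "2 * pi * of_int j / real N = 2 * pi * of_int n"
      using assms by simp
    then have "\<omega> = cis (2 * pi * of_int n)"
      by (simp only: \<omega>_def)
    also have "\<dots> = 1"
      by (rule cis_multiple_2pi) auto
    finally show "\<omega> = 1" .
  qed
  show ?thesis
  proof (cases "\<omega> = 1")
    case True
    then show ?thesis using iff by (simp add: pw)
  next
    case False
    then have "(\<Sum>k<N. \<omega> ^ k) = 0"
      using geometric_sum[OF False, of N] by (simp add: \<omega>N)
    then show ?thesis using iff False by (simp add: pw)
  qed
qed

lemma poly_eq_sum_lessThan:
  fixes P :: "'a::comm_semiring_1 poly"
  assumes "degree P < N"
  shows "poly P z = (\<Sum>i<N. coeff P i * z ^ i)"
proof -
  have "poly P z = (\<Sum>i\<le>degree P. coeff P i * z ^ i)"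
    by (rule poly_altdef)
  also have "\<dots> = (\<Sum>i<N. coeff P i * z ^ i)"
    using assms by (intro sum.mono_neutral_left) (auto simp: coeff_eq_0)
  finally show ?thesis .
qed

lemma discrete_Parseval:
  assumes "degree P < N" "degree Q < N"
  shows "(\<Sum>k<N. poly P (uroot N k) * cnj (poly Q (uroot N k))) =
         of_nat N * (\<Sum>i<N. coeff P i * cnj (coeff Q i))"
proof -
  have N: "0 < N" using assms by simp
  have cc: "uroot N k ^ i * cnj (uroot N k) ^ j = uroot N k powi (int i - int j)" for i j k
    unfolding uroot_def cis_power_int cis_cnj Complex.DeMoivre cis_mult
    by (rule arg_cong[of _ _ cis]) (simp add: algebra_simps diff_divide_distrib)
  have "(\<Sum>k<N. poly P (uroot N k) * cnj (poly Q (uroot N k))) =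
     (\<Sum>k<N. \<Sum>i<N. \<Sum>j<N. coeff P i * cnj (coeff Q j) * uroot N k powi (int i - int j))"
    unfolding poly_eq_sum_lessThan[OF assms(1)] poly_eq_sum_lessThan[OF assms(2)]
      cnj_sum sum_product
    by (intro sum.cong refl) (simp add: cc[symmetric])
  also have "\<dots> = (\<Sum>i<N. \<Sum>j<N. \<Sum>k<N. coeff P i * cnj (coeff Q j) * uroot N k powi (int i - int j))"
    by (subst sum.swap) (intro sum.cong refl sum.swap)
  also have "\<dots> = (\<Sum>i<N. \<Sum>j<N. if i = j then of_nat N * (coeff P i * cnj (coeff Q i)) else 0)"
  proof (intro sum.cong refl)
    fix i j assume "i \<in> {..<N}" "j \<in> {..<N}"
    \<comment> \<open>No aliasing: two exponents below \<open>N\<close> differ by less than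
      \<open>N\<close>, so only the diagonal survives.\<close>
    then have "int N dvd int i - int j \<longleftrightarrow> i = j"
      using zdvd_imp_le[of "int N" "int i - int j"] zdvd_imp_le[of "int N" "int j - int i"]
      by (cases i j rule: linorder_cases) (auto simp: dvd_diff_commute)
    then show "(\<Sum>k<N. coeff P i * cnj (coeff Q j) * uroot N k powi (int i - int j)) =
        (if i = j then of_nat N * (coeff P i * cnj (coeff Q i)) else 0)"
      by (simp add: sum_distrib_left[symmetric] sum_uroot_powi[OF N])
  qed
  also have "\<dots> = of_nat N * (\<Sum>i<N. coeff P i * cnj (coeff Q i))"
    by (simp add: sum_distrib_left)
  finally show ?thesis .
qed

lemma discrete_Parseval_norm:
  assumes "degree P < N"
  shows "(\<Sum>k<N. (norm (poly P (uroot N k)))\<^sup>2) = real N * (\<Sum>i<N. (norm (coeff P i))\<^sup>2)"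
proof -
  have "complex_of_real (\<Sum>k<N. (norm (poly P (uroot N k)))\<^sup>2) =
        complex_of_real (real N * (\<Sum>i<N. (norm (coeff P i))\<^sup>2))"
    using discrete_Parseval[OF assms assms] by (simp add: complex_norm_square del: of_real_power)
  then show ?thesis by (simp only: of_real_eq_iff)
qed

lemma discrete_mean_value:
  assumes "degree P < N"
  shows "(\<Sum>k<N. poly P (uroot N k)) = of_nat N * coeff P 0"
proof -
  have "(\<Sum>i<N. coeff P i * cnj (coeff 1 i)) = (\<Sum>i<N. if i = 0 then coeff P 0 else 0)"
    by (intro sum.cong) auto
  also have "\<dots> = coeff P 0" using assms by simp
  finally show ?thesis
    using discrete_Parseval[OF assms, of 1] assms by simp
qed

text \<open>Greedy choice of signs: averaging over both signs of the last coefficient replaces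
  Khinchine's inequality.\<close>

lemma exists_signs_fourth_moment:
  fixes lam :: "nat \<Rightarrow> real"
  assumes "n \<le> N" "0 < N"
  shows "\<exists>\<epsilon>. (\<forall>i. \<bar>\<epsilon> i\<bar> = 1) \<and>
    (\<Sum>k<N. (norm (\<Sum>i<n. of_real (\<epsilon> i * lam i) * uroot N k ^ i)) ^ 4) \<le> 3 * real N * (\<Sum>i<n. (lam i)\<^sup>2)\<^sup>2"
  using assms(1)
proof (induction n)
  case 0
  show ?case by (rule exI[of _ "\<lambda>_. 1"]) simp
next
  case (Suc n)
  then obtain \<epsilon> :: "nat \<Rightarrow> real" where \<epsilon>: "\<And>i. \<bar>\<epsilon> i\<bar> = 1" and
    IH: "(\<Sum>k<N. (norm (\<Sum>i<n. of_real (\<epsilon> i * lam i) * uroot N k ^ i)) ^ 4) \<le> 3 * real N * (\<Sum>i<n. (lam i)\<^sup>2)\<^sup>2"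
    by auto
  define F where "F k = (\<Sum>i<n. of_real (\<epsilon> i * lam i) * uroot N k ^ i)" for k
  define S where "S = (\<Sum>i<n. (lam i)\<^sup>2)"
  define l where "l = lam n"
  define T where "T s = (\<Sum>k<N. (norm (F k + of_real (s * l) * uroot N k ^ n)) ^ 4)" for s :: real
  have \<epsilon>2: "(\<epsilon> i)\<^sup>2 = 1" for i using \<epsilon>[of i] by (metis power2_abs power_one)
  have S2: "(\<Sum>k<N. (norm (F k))\<^sup>2) = real N * S"
  proof -
    define P where "P = Poly (map (\<lambda>i. complex_of_real (\<epsilon> i * lam i)) [0..<n])"
    have cP: "coeff P i = (if i < n then of_real (\<epsilon> i * lam i) else 0)" for i
      by (simp add: P_def nth_default_def)
    have deg: "degree P < N"
      using Suc.prems by (intro le_less_trans[OF degree_le[of "n - 1"]]) (auto simp: cP)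
    have "F k = poly P (uroot N k)" for k
      unfolding F_def poly_eq_sum_lessThan[OF deg] using Suc.prems
      by (intro sum.mono_neutral_cong_left) (auto simp: cP)
    then have "(\<Sum>k<N. (norm (F k))\<^sup>2) = real N * (\<Sum>i<N. (norm (coeff P i))\<^sup>2)"
      using discrete_Parseval_norm[OF deg] by simp
    also have "(\<Sum>i<N. (norm (coeff P i))\<^sup>2) = S"
      unfolding S_def using Suc.prems
      by (intro sum.mono_neutral_cong_right) (auto simp: cP norm_mult power_mult_distrib \<epsilon>2)
    finally show ?thesis .
  qed
  \<comment> \<open>Adding the expansions for both signs cancels the cross term linear in the inner
    product \<open>c\<close>. Only \<open>8 * c\<^sup>2\<close> remains, and Cauchy-Schwarz bounds
    it.\<close>
  have pt: "(norm (F k + of_real l * uroot N k ^ n)) ^ 4 + (norm (F k + of_real (- l) * uroot N k ^ n)) ^ 4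
     \<le> 2 * (norm (F k)) ^ 4 + 12 * l\<^sup>2 * (norm (F k))\<^sup>2 + 2 * l ^ 4" for k
  proof -
    define u where "u = of_real l * uroot N k ^ n"
    have nu: "(norm u)\<^sup>2 = l\<^sup>2" by (simp add: u_def norm_mult)
    define c where "c = F k \<bullet> u"
    have c: "c\<^sup>2 \<le> (norm (F k))\<^sup>2 * l\<^sup>2"
      using Cauchy_Schwarz_ineq[of "F k" u] nu by (simp add: c_def power2_norm_eq_inner)
    have p: "(norm (F k + u))\<^sup>2 = (norm (F k))\<^sup>2 + l\<^sup>2 + 2 * c"
      using nu by (simp add: power2_norm_eq_inner c_def inner_add inner_commute algebra_simps)
    have m: "(norm (F k - u))\<^sup>2 = (norm (F k))\<^sup>2 + l\<^sup>2 - 2 * c"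
      using nu by (simp add: power2_norm_eq_inner c_def inner_diff inner_commute algebra_simps)
    have "(norm (F k + u)) ^ 4 + (norm (F k - u)) ^ 4 = ((norm (F k + u))\<^sup>2)\<^sup>2 + ((norm (F k - u))\<^sup>2)\<^sup>2"
      by simp
    also have "\<dots> = 2 * ((norm (F k))\<^sup>2 + l\<^sup>2)\<^sup>2 + 8 * c\<^sup>2"
      unfolding p m by (simp add: power2_eq_square algebra_simps)
    also have "\<dots> \<le> 2 * ((norm (F k))\<^sup>2 + l\<^sup>2)\<^sup>2 + 8 * ((norm (F k))\<^sup>2 * l\<^sup>2)"
      using c by simp
    also have "\<dots> = 2 * (norm (F k)) ^ 4 + 12 * l\<^sup>2 * (norm (F k))\<^sup>2 + 2 * l ^ 4"
      by (simp add: power2_eq_square power4_eq_xxxx algebra_simps)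
    finally show ?thesis by (simp add: u_def)
  qed
  have "T 1 + T (-1) \<le> (\<Sum>k<N. 2 * (norm (F k)) ^ 4 + 12 * l\<^sup>2 * (norm (F k))\<^sup>2 + 2 * l ^ 4)"
    unfolding T_def sum.distrib[symmetric] by (intro sum_mono) (use pt in simp)
  also have "\<dots> = 2 * (\<Sum>k<N. (norm (F k)) ^ 4) + 12 * l\<^sup>2 * (real N * S) + 2 * real N * l ^ 4"
    by (simp add: sum.distrib sum_distrib_left[symmetric] S2)
  \<comment> \<open>The coefficient of \<open>l ^ 4\<close> is raised from 2 to 6 so that the three
    terms form the square of \<open>S + l\<^sup>2\<close>.\<close>
  also have "\<dots> \<le> 2 * (3 * real N * S\<^sup>2) + 12 * l\<^sup>2 * (real N * S) + 6 * real N * l ^ 4"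
    using IH by (intro add_mono mult_left_mono) (auto simp: F_def S_def)
  also have "\<dots> = 2 * (3 * real N * (S + l\<^sup>2)\<^sup>2)"
    by (simp add: power2_eq_square power4_eq_xxxx algebra_simps)
  finally have "T 1 \<le> 3 * real N * (S + l\<^sup>2)\<^sup>2 \<or> T (-1) \<le> 3 * real N * (S + l\<^sup>2)\<^sup>2"
    by linarith
  then obtain s :: real where s: "\<bar>s\<bar> = 1" "T s \<le> 3 * real N * (S + l\<^sup>2)\<^sup>2"
    by (elim disjE) (use that[of 1] that[of "-1"] in auto)
  show ?case
  proof (intro exI[of _ "\<epsilon>(n := s)"] conjI allI)
    show "\<bar>(\<epsilon>(n := s)) i\<bar> = 1" for i using \<epsilon> s by simp
    show "(\<Sum>k<N. (norm (\<Sum>i<Suc n. of_real ((\<epsilon>(n := s)) i * lam i) * uroot N k ^ i)) ^ 4)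
          \<le> 3 * real N * (\<Sum>i<Suc n. (lam i)\<^sup>2)\<^sup>2"
      using s(2) by (simp add: T_def F_def S_def l_def)
  qed
qed

section \<open>Analytic completion of the squared modulus of a polynomial\<close>

text \<open>On the circle |F|^2 is a real trigonometric polynomial, hence the real part of an
  analytic one. The induction uses |a + z F|^2 = |a|^2 + |F|^2 + 2 Re (cnj a z F). The real constant
  coefficient makes the mean of the square of \<open>H\<close> nonnegative later.\<close>

lemma exists_poly_Re_eq_norm_square:
  fixes F :: "complex poly"
  shows "\<exists>H. (\<forall>z. norm z = 1 \<longrightarrow> Re (poly H z) = (norm (poly F z))\<^sup>2) \<and> Im (coeff H 0) = 0"
proof (induction F)
  case 0
  show ?case by (rule exI[of _ 0]) simp
next
  case (pCons a F)
  then obtain H where H: "\<And>z. norm z = 1 \<Longrightarrow> Re (poly H z) = (norm (poly F z))\<^sup>2" "Im (coeff H 0) = 0"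
    by blast
  define H' where "H' = [:of_real ((norm a)\<^sup>2):] + H + smult (2 * cnj a) (pCons 0 F)"
  have "Re (poly H' z) = (norm (poly (pCons a F) z))\<^sup>2" if "norm z = 1" for z
  proof -
    define w where "w = z * poly F z"
    have "(norm (poly (pCons a F) z))\<^sup>2 = (norm (a + w))\<^sup>2"
      by (simp add: w_def)
    also have "\<dots> = (norm a)\<^sup>2 + (norm w)\<^sup>2 + 2 * Re (cnj a * w)"
      unfolding cmod_power2 by (simp add: power2_eq_square algebra_simps)
    also have "norm w = norm (poly F z)"
      by (simp add: w_def norm_mult that)
    finally show ?thesis
      using H(1)[OF that] by (simp add: H'_def w_def mult_ac)
  qed
  moreover have "Im (coeff H' 0) = 0"
    using H(2) by (simp add: H'_def)
  ultimately show ?case by blast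
qed

subsection \<open>Bounded analytic polynomials with large coefficients\<close>

lemma poly_bounded_on_circle:
  fixes P :: "complex poly"
  obtains M where "1 \<le> M" "\<And>z. norm z = 1 \<Longrightarrow> norm (poly P z) \<le> M"
proof
  let ?M = "1 + (\<Sum>i\<le>degree P. norm (coeff P i))"
  show "1 \<le> ?M" by (simp add: sum_nonneg)
  fix z :: complex assume "norm z = 1"
  then have "norm (poly P z) \<le> (\<Sum>i\<le>degree P. norm (coeff P i))"
    unfolding poly_altdef by (intro sum_norm_le) (simp add: norm_mult norm_power)
  then show "norm (poly P z) \<le> ?M" by simp
qed

text \<open>Neumann series: since \<open>H\<close> takes values in a half plane away from 0 and is
  bounded, \<open>1 - \<kappa> H\<close> is a strict contraction for small \<kappa>, and the
  truncated geometric series in it is a polynomial.\<close>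

lemma poly_approx_inverse_on_circle:
  fixes H :: "complex poly"
  assumes H: "\<And>z. norm z = 1 \<Longrightarrow> 1 \<le> Re (poly H z)" and "0 < \<delta>"
  shows "\<exists>Q. \<forall>z. norm z = 1 \<longrightarrow> norm (poly Q z - inverse (poly H z)) \<le> \<delta>"
proof -
  obtain M where M: "1 \<le> M" "\<And>z. norm z = 1 \<Longrightarrow> norm (poly H z) \<le> M"
    using poly_bounded_on_circle by blast
  \<comment> \<open>This value minimizes the bound
    \<open>1 - 2 * \<kappa> + \<kappa>\<^sup>2 * M\<^sup>2\<close> for the squared norm of
    \<open>1 - \<kappa> H\<close>; the minimum is \<open>q\<^sup>2\<close>.\<close>
  define \<kappa> where "\<kappa> = 1 / M\<^sup>2"
  define q where "q = sqrt (1 - 1 / M\<^sup>2)"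
  have M2: "1 / M\<^sup>2 \<le> 1" "0 < 1 / M\<^sup>2" using M(1) by (auto simp: divide_simps)
  then have q: "0 \<le> q" "q < 1" by (auto simp: q_def)
  obtain n where n: "q ^ n < \<delta>"
    using real_arch_pow_inv[OF \<open>0 < \<delta>\<close> q(2)] by blast
  define Q where "Q = smult (of_real \<kappa>) (\<Sum>j<n. (1 - smult (of_real \<kappa>) H) ^ j)"
  have "norm (poly Q z - inverse (poly H z)) \<le> \<delta>" if z: "norm z = 1" for z
  proof -
    define h where "h = poly H z"
    define x where "x = 1 - of_real \<kappa> * h"
    have h: "1 \<le> Re h" "norm h \<le> M" using H[OF z] M(2)[OF z] by (auto simp: h_def)
    have h0: "h \<noteq> 0" and nh: "1 \<le> norm h"
      using h(1) complex_Re_le_cmod[of h] by auto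
    have \<kappa>0: "0 < \<kappa>" using M2 by (simp add: \<kappa>_def)
    have "(norm x)\<^sup>2 = 1 - 2 * \<kappa> * Re h + \<kappa>\<^sup>2 * (norm h)\<^sup>2"
      unfolding cmod_power2 by (simp add: x_def power2_eq_square algebra_simps)
    also have "\<dots> \<le> 1 - 2 * \<kappa> * 1 + \<kappa>\<^sup>2 * M\<^sup>2"
      using h \<kappa>0 by (intro add_mono diff_mono mult_left_mono power_mono) auto
    also have "\<dots> = 1 - 1 / M\<^sup>2"
      using M(1) by (simp add: \<kappa>_def power2_eq_square)
    finally have "norm x \<le> q"
      unfolding q_def by (rule real_le_rsqrt)
    then have "norm x ^ n \<le> q ^ n" by (intro power_mono) auto
    have "poly Q z = of_real \<kappa> * (\<Sum>j<n. x ^ j)"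
      by (simp add: Q_def poly_sum poly_power x_def h_def)
    moreover have "(1 - x) * (\<Sum>j<n. x ^ j) = 1 - x ^ n"
      by (rule one_diff_power_eq[symmetric])
    ultimately have "poly Q z * h = 1 - x ^ n"
      by (simp add: x_def mult_ac)
    then have "poly Q z = (1 - x ^ n) / h"
      using h0 by (simp add: eq_divide_eq)
    then have "poly Q z - inverse h = - (x ^ n) / h"
      by (simp add: inverse_eq_divide flip: diff_divide_distrib)
    then have "norm (poly Q z - inverse h) = norm x ^ n / norm h"
      by (simp add: norm_divide norm_power)
    also have "\<dots> \<le> norm x ^ n / 1"
      using nh by (intro divide_left_mono) auto
    also have "\<dots> \<le> \<delta>" using \<open>norm x ^ n \<le> q ^ n\<close> n by simp
    finally show ?thesis by (simp add: h_def)
  qed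
  then show ?thesis by blast
qed

text \<open>With \<open>F = \<Sum>\<plusminus>lam\<^sub>i z\<^sup>i\<close> of small fourth moment, \<open>F / H\<close> is a bounded analytic
  substitute for the unimodular function \<open>F / |F|\<close>: since \<open>Re H = 1 + |F|\<^sup>2\<close> on the circle,
  \<open>|F / H| \<le> 1/2\<close> there, while the mean of \<open>Re (F / H \<cdot> cnj F) = |F|\<^sup>2 Re H / |H|\<^sup>2\<close> stays away
  from 0 because the mean of \<open>|H|\<^sup>2\<close> is at most twice that of \<open>(Re H)\<^sup>2\<close>.\<close>

lemma exists_poly_large_coeffs_normalized:
  fixes lam :: "nat \<Rightarrow> real"
  assumes lam: "(\<Sum>i<n. (lam i)\<^sup>2) = 1"
  shows "\<exists>G :: complex poly. (\<forall>z. norm z = 1 \<longrightarrow> norm (poly G z) \<le> 1) \<and> 1 / 24 \<le> (\<Sum>i<n. \<bar>lam i\<bar> * norm (coeff G i))"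
proof -
  have n: "0 < n" using lam by (cases n) auto
  obtain \<epsilon> where \<epsilon>: "\<And>i. \<bar>\<epsilon> i\<bar> = 1" and
    four: "(\<Sum>k<2*n. (norm (\<Sum>i<n. of_real (\<epsilon> i * lam i) * uroot (2*n) k ^ i)) ^ 4) \<le> 3 * real (2*n)"
    using exists_signs_fourth_moment[of n "2*n" lam] n lam by auto
  define F where "F = Poly (map (\<lambda>i. complex_of_real (\<epsilon> i * lam i)) [0..<n])"
  have cF: "coeff F i = (if i < n then of_real (\<epsilon> i * lam i) else 0)" for i
    by (simp add: F_def nth_default_def)
  have degF: "degree F < n"
    using n by (intro le_less_trans[OF degree_le[of "n - 1"]]) (auto simp: cF)
  have degF2: "degree (F^2) < 2 * n"
    using degF degree_power_le[of F 2] by simp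
  have polyF: "poly F z = (\<Sum>i<n. of_real (\<epsilon> i * lam i) * z ^ i)" for z
    unfolding poly_eq_sum_lessThan[OF degF] by (intro sum.cong) (auto simp: cF)
  \<comment> \<open>The fourth moment of \<open>F\<close> is the second moment of
    \<open>F^2\<close>, whose degree is below \<open>2 * n\<close>. Hence the sampled bound controls
    the coefficients of \<open>F^2\<close> and carries over to any larger number of sample
    points.\<close>
  have F4: "(\<Sum>i<2*n. (norm (coeff (F^2) i))\<^sup>2) \<le> 3"
  proof -
    have "real (2*n) * (\<Sum>i<2*n. (norm (coeff (F^2) i))\<^sup>2) = (\<Sum>k<2*n. norm (poly F (uroot (2*n) k)) ^ 4)"
      unfolding discrete_Parseval_norm[OF degF2, symmetric] by (simp add: poly_power norm_power)
    also have "\<dots> \<le> real (2*n) * 3"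
      using four by (simp add: polyF)
    finally show ?thesis using n by (subst (asm) mult_le_cancel_left_pos) auto
  qed
  obtain H0 where H0: "\<And>z. norm z = 1 \<Longrightarrow> Re (poly H0 z) = (norm (poly F z))\<^sup>2" "Im (coeff H0 0) = 0"
    using exists_poly_Re_eq_norm_square[of F] by blast
  define H where "H = 1 + H0"
  have ReH: "Re (poly H z) = 1 + (norm (poly F z))\<^sup>2" if "norm z = 1" for z
    using H0(1)[OF that] by (simp add: H_def)
  obtain M where M: "1 \<le> M" "\<And>z. norm z = 1 \<Longrightarrow> norm (poly F z) \<le> M"
    using poly_bounded_on_circle by blast
  \<comment> \<open>Replacing the inverse of \<open>H\<close> by \<open>Q\<close> costs at most
    \<open>\<delta> * M\<close> in the sup norm of \<open>G\<close>, which fits into the half left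
    free by |F / H| \<le> 1/2. It costs at most \<delta> \<le> 1/24 in the final mean.\<close>
  define \<delta> where "\<delta> = 1 / (24 * M)"
  have \<delta>: "0 < \<delta>" "\<delta> \<le> 1 / 24" "\<delta> * M \<le> 1 / 2" using M(1) by (auto simp: \<delta>_def field_simps)
  obtain Q where Q: "\<And>z. norm z = 1 \<Longrightarrow> norm (poly Q z - inverse (poly H z)) \<le> \<delta>"
    using poly_approx_inverse_on_circle[of H \<delta>] \<delta>(1) ReH by auto
  define G where "G = F * Q"
  have bound: "norm (poly G z) \<le> 1" if z: "norm z = 1" for z
  proof -
    define f where "f = norm (poly F z)"
    have f: "0 \<le> f" "f \<le> M" using M(2)[OF z] by (auto simp: f_def)
    have "1 + f\<^sup>2 \<le> norm (poly H z)"
      using complex_Re_le_cmod[of "poly H z"] ReH[OF z] by (simp add: f_def)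
    moreover have "0 < 1 + f\<^sup>2" by (simp add: add_pos_nonneg)
    ultimately have "norm (inverse (poly H z)) \<le> 1 / (1 + f\<^sup>2)"
      unfolding norm_inverse by (simp add: le_imp_inverse_le flip: inverse_eq_divide)
    then have "norm (poly Q z) \<le> 1 / (1 + f\<^sup>2) + \<delta>"
      using Q[OF z] norm_triangle_sub[of "poly Q z" "inverse (poly H z)"] by linarith
    then have "f * norm (poly Q z) \<le> f * (1 / (1 + f\<^sup>2) + \<delta>)"
      using f by (intro mult_left_mono)
    also have "\<dots> = f / (1 + f\<^sup>2) + f * \<delta>" by (simp add: algebra_simps)
    also have "f / (1 + f\<^sup>2) \<le> 1 / 2"
      using \<open>0 < 1 + f\<^sup>2\<close> sum_power2_ge_zero[of "f - 1" 0]
      by (simp add: divide_simps power2_eq_square algebra_simps)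
    also have "f * \<delta> \<le> M * \<delta>" using f \<delta> by (intro mult_right_mono) auto
    also have "\<dots> \<le> 1 / 2" using \<delta>(3) by (simp add: mult_ac)
    finally show ?thesis by (simp add: G_def norm_mult f_def)
  qed
  \<comment> \<open>The degree of \<open>Q\<close> is uncontrolled, so the sampling is refined until
    every polynomial involved has degree below \<open>N\<close>.\<close>
  define N where "N = Suc (2 * n + degree (F^2) + degree H + degree (H^2) + degree G)"
  have N: "2 * n < N" "degree F < N" "degree (F^2) < N" "degree H < N" "degree (H^2) < N" "degree G < N" "0 < N"
    using degF by (auto simp: N_def)
  define f where "f k = norm (poly F (uroot N k))" for k
  define h where "h k = poly H (uroot N k)" for k
  have Reh: "Re (h k) = 1 + (f k)\<^sup>2" for k by (simp add: h_def f_def ReH)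
  have sumF2: "(\<Sum>k<N. (f k)\<^sup>2) = real N"
  proof -
    have e2: "(\<epsilon> i)\<^sup>2 = 1" for i using \<epsilon>[of i] by (metis power2_abs power_one)
    have "(\<Sum>i<N. (norm (coeff F i))\<^sup>2) = (\<Sum>i<n. (lam i)\<^sup>2)"
      using N(1) by (intro sum.mono_neutral_cong_right) (auto simp: cF norm_mult power_mult_distrib e2)
    then show ?thesis
      using discrete_Parseval_norm[OF N(2)] lam by (simp add: f_def)
  qed
  have sumF4: "(\<Sum>k<N. (f k) ^ 4) \<le> 3 * real N"
  proof -
    have "(\<Sum>k<N. (f k) ^ 4) = real N * (\<Sum>i<N. (norm (coeff (F^2) i))\<^sup>2)"
      unfolding discrete_Parseval_norm[OF N(3), symmetric] by (simp add: poly_power norm_power f_def)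
    also have "(\<Sum>i<N. (norm (coeff (F^2) i))\<^sup>2) = (\<Sum>i<2*n. (norm (coeff (F^2) i))\<^sup>2)"
      using N(1) degF2 by (intro sum.mono_neutral_right) (auto intro!: coeff_eq_0)
    also have "real N * \<dots> \<le> real N * 3" using F4 by (intro mult_left_mono) auto
    finally show ?thesis by simp
  qed
  have sumH: "(\<Sum>k<N. (norm (h k))\<^sup>2) \<le> 12 * real N"
  proof -
    \<comment> \<open>The mean of \<open>H^2\<close> is the square of a real number, and
      \<open>Re (h\<^sup>2) = 2 * (Re h)\<^sup>2 - (norm h)\<^sup>2\<close>. So the mean of |H|^2 is
      at most that of 2 (1 + |F|^2)^2, which is at most 2 + 4 + 6.\<close>
    have "(\<Sum>k<N. (h k)\<^sup>2) = of_nat N * (coeff H 0)\<^sup>2"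
      using discrete_mean_value[OF N(5)] by (simp add: h_def poly_power power2_eq_square coeff_mult)
    moreover have "0 \<le> Re ((coeff H 0)\<^sup>2)"
      using H0(2) by (simp add: H_def power2_eq_square)
    ultimately have "0 \<le> (\<Sum>k<N. Re ((h k)\<^sup>2))"
      by (simp flip: Re_sum)
    also have "\<dots> = (\<Sum>k<N. 2 * (Re (h k))\<^sup>2 - (norm (h k))\<^sup>2)"
      unfolding cmod_power2 by (intro sum.cong) (auto simp: power2_eq_square)
    finally have "(\<Sum>k<N. (norm (h k))\<^sup>2) \<le> (\<Sum>k<N. 2 * (Re (h k))\<^sup>2)"
      by (simp add: sum_subtractf)
    also have "\<dots> = (\<Sum>k<N. 2 + 4 * (f k)\<^sup>2 + 2 * (f k)^4)"
      by (intro sum.cong) (auto simp: Reh power2_eq_square power4_eq_xxxx algebra_simps)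
    also have "\<dots> = 2 * real N + 4 * real N + 2 * (\<Sum>k<N. (f k) ^ 4)"
      by (simp add: sum.distrib sum_distrib_left[symmetric] sumF2)
    also have "\<dots> \<le> 12 * real N" using sumF4 by simp
    finally show ?thesis .
  qed
  \<comment> \<open>For any t, f^4 / g^2 \<ge> 2 t f^2 - t^2 g^2 by completing a square. With mean
    f^2 = 1 and mean g^2 at most 12, the mean of the right side is at least 2 t - 12 t^2, which is
    largest at t = 1/12 with value 1/12; subtracting \<delta> leaves 1/24.\<close>
  have pointwise: "(1/6 - \<delta>) * (f k)\<^sup>2 - 1/144 * (norm (h k))\<^sup>2
      \<le> Re (poly G (uroot N k) * cnj (poly F (uroot N k)))" for k
  proof -
    define w where "w = poly Q (uroot N k) - inverse (h k)"
    have w: "norm w \<le> \<delta>" using Q[of "uroot N k"] by (simp add: w_def h_def)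
    define g where "g = norm (h k)"
    have "1 \<le> Re (h k)" by (simp add: Reh)
    then have g: "0 < g" using complex_Re_le_cmod[of "h k"] unfolding g_def by linarith
    have "poly G (uroot N k) * cnj (poly F (uroot N k)) = of_real ((f k)\<^sup>2) * (inverse (h k) + w)"
      unfolding f_def w_def complex_norm_square G_def by (simp only: poly_mult mult_ac) simp
    then have e1: "Re (poly G (uroot N k) * cnj (poly F (uroot N k))) = (f k)\<^sup>2 * (Re (inverse (h k)) + Re w)"
      by simp
    have e2: "Re (inverse (h k)) = (1 + (f k)\<^sup>2) / g\<^sup>2"
      using Reh[of k] by (simp add: g_def cmod_power2)
    have e3: "(f k)\<^sup>2 * (- \<delta>) \<le> (f k)\<^sup>2 * Re w"
      using w abs_Re_le_cmod[of w] by (intro mult_left_mono) auto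
    have e4: "1/6 * (f k)\<^sup>2 - 1/144 * g\<^sup>2 \<le> (f k)\<^sup>2 * ((1 + (f k)\<^sup>2) / g\<^sup>2)"
    proof -
      have "0 \<le> ((f k)\<^sup>2 / g - g / 12)\<^sup>2" by simp
      also have "\<dots> = (f k)\<^sup>2 * ((f k)\<^sup>2 / g\<^sup>2) - 1/6 * (f k)\<^sup>2 + 1/144 * g\<^sup>2"
        using g by (simp add: power2_eq_square field_simps)
      also have "(f k)\<^sup>2 * ((f k)\<^sup>2 / g\<^sup>2) \<le> (f k)\<^sup>2 * ((1 + (f k)\<^sup>2) / g\<^sup>2)"
        by (intro mult_left_mono divide_right_mono) auto
      finally show ?thesis by simp
    qed
    show ?thesis
      using e3 e4 unfolding e1 e2 g_def[symmetric] by (simp add: distrib_left left_diff_distrib right_diff_distrib mult.commute)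
  qed
  have "real N * (1 / 24) \<le> real N * (1/6 - \<delta> - 1/12)"
    using \<delta>(2) by (intro mult_left_mono) auto
  also have "\<dots> = (1/6 - \<delta>) * real N - 1/144 * (12 * real N)"
    by (simp add: algebra_simps)
  also have "\<dots> \<le> (1/6 - \<delta>) * (\<Sum>k<N. (f k)\<^sup>2) - 1/144 * (\<Sum>k<N. (norm (h k))\<^sup>2)"
    using sumF2 sumH by simp
  also have "\<dots> = (\<Sum>k<N. (1/6 - \<delta>) * (f k)\<^sup>2 - 1/144 * (norm (h k))\<^sup>2)"
    by (simp add: sum_subtractf sum_distrib_left)
  also have "\<dots> \<le> (\<Sum>k<N. Re (poly G (uroot N k) * cnj (poly F (uroot N k))))"
    by (intro sum_mono pointwise)
  also have "\<dots> = real N * (\<Sum>i<N. Re (coeff G i * cnj (coeff F i)))"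
    unfolding Re_sum[symmetric] discrete_Parseval[OF N(6) N(2)] by simp
  finally have "1 / 24 \<le> (\<Sum>i<N. Re (coeff G i * cnj (coeff F i)))"
    using N(7) by (subst (asm) mult_le_cancel_left_pos) auto
  also have "\<dots> \<le> (\<Sum>i<N. norm (coeff G i * cnj (coeff F i)))"
    by (intro sum_mono complex_Re_le_cmod)
  also have "\<dots> = (\<Sum>i<n. \<bar>lam i\<bar> * norm (coeff G i))"
    using N(1) by (intro sum.mono_neutral_cong_right) (auto simp: cF norm_mult abs_mult \<epsilon>)
  finally show ?thesis using bound by blast
qed

lemma exists_poly_large_coeffs:
  fixes lam :: "nat \<Rightarrow> real"
  shows "\<exists>G :: complex poly. (\<forall>z. norm z = 1 \<longrightarrow> norm (poly G z) \<le> 1) \<and>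
     sqrt (\<Sum>i<n. (lam i)\<^sup>2) / 24 \<le> (\<Sum>i<n. \<bar>lam i\<bar> * norm (coeff G i))"
proof (cases "(\<Sum>i<n. (lam i)\<^sup>2) = 0")
  case True
  then show ?thesis by (intro exI[of _ 0]) simp
next
  case False
  define s where "s = sqrt (\<Sum>i<n. (lam i)\<^sup>2)"
  have s: "0 < s" "s\<^sup>2 = (\<Sum>i<n. (lam i)\<^sup>2)"
    using False sum_nonneg[of "{..<n}" "\<lambda>i. (lam i)\<^sup>2"] by (auto simp: s_def)
  have "(\<Sum>i<n. (lam i / s)\<^sup>2) = 1"
    using s False by (simp add: power_divide flip: sum_divide_distrib)
  from exists_poly_large_coeffs_normalized[OF this] obtain G :: "complex poly" where
    G: "\<And>z. norm z = 1 \<Longrightarrow> norm (poly G z) \<le> 1" and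
    le: "1 / 24 \<le> (\<Sum>i<n. \<bar>lam i / s\<bar> * norm (coeff G i))" by blast
  have "s * (1 / 24) \<le> s * (\<Sum>i<n. \<bar>lam i / s\<bar> * norm (coeff G i))"
    using le s(1) by (intro mult_left_mono) auto
  also have "\<dots> = (\<Sum>i<n. \<bar>lam i\<bar> * norm (coeff G i))"
    unfolding sum_distrib_left using s(1) by (intro sum.cong) auto
  finally show ?thesis using G by (auto simp: s_def)
qed

subsection \<open>Localization to a block of frequencies\<close>

text \<open>The polynomials found so far have uncontrolled degree, and plain truncation may increase
  the sup norm. The Fejer mean does not: it averages rotations of \<open>G\<close> against a
  nonnegative kernel of mean \<open>L\<close>.\<close>

lemma norm_Fejer_mean_le:
  fixes G :: "complex poly"
  assumes G: "\<And>z. norm z = 1 \<Longrightarrow> norm (poly G z) \<le> 1" and "0 < L" and z: "norm z = 1"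
  shows "norm (\<Sum>i<L. of_real (real (L - i) / real L) * coeff G i * z ^ i) \<le> 1"
proof -
  define E where "E = Poly (replicate L (1::complex))"
  have cE: "coeff E i = (if i < L then 1 else 0)" for i
    by (simp add: E_def nth_default_def)
  define N where "N = degree G + L"
  have N: "0 < N" "degree G < N" using \<open>0 < L\<close> by (auto simp: N_def)
  have degE: "degree E < N"
    using \<open>0 < L\<close> by (intro le_less_trans[OF degree_le[of "L - 1"]]) (auto simp: cE N_def)
  define K where "K k = (norm (poly E (uroot N k)))\<^sup>2" for k
  \<comment> \<open>The truncated subtraction \<open>L - m\<close> is 0 from \<open>m = L\<close>
    on, which removes the high coefficients of \<open>G\<close>. The choice of \<open>N\<close>
    keeps the shifted polynomial \<open>monom 1 m * E\<close> below degree \<open>N\<close>.\<close>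
  have kernel: "(\<Sum>k<N. uroot N k ^ m * of_real (K k)) = of_nat N * of_nat (L - m)" if "m \<le> degree G" for m
  proof -
    have "degree (monom 1 m * E) < N"
      using that \<open>0 < L\<close>
      by (intro le_less_trans[OF degree_le[of "m + L - 1"]]) (auto simp: coeff_monom_mult cE N_def)
    from discrete_Parseval[OF this degE]
    have "(\<Sum>k<N. uroot N k ^ m * of_real (K k)) = of_nat N * (\<Sum>i<N. coeff (monom 1 m * E) i * cnj (coeff E i))"
      by (simp add: K_def poly_monom complex_norm_square mult.assoc del: of_real_power)
    also have "(\<Sum>i<N. coeff (monom 1 m * E) i * cnj (coeff E i)) = (\<Sum>i\<in>{m..<L}. 1)"
      by (intro sum.mono_neutral_cong_right) (auto simp: coeff_monom_mult cE N_def)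
    finally show ?thesis by simp
  qed
  have "(\<Sum>k<N. poly G (z * uroot N k) * of_real (K k)) =
        (\<Sum>k<N. \<Sum>i\<le>degree G. coeff G i * z ^ i * (uroot N k ^ i * of_real (K k)))"
    unfolding poly_altdef sum_distrib_right by (simp add: power_mult_distrib mult_ac)
  also have "\<dots> = (\<Sum>i\<le>degree G. coeff G i * z ^ i * (of_nat N * of_nat (L - i)))"
    by (subst sum.swap) (simp add: kernel flip: sum_distrib_left)
  also have "\<dots> = (\<Sum>i<N. coeff G i * z ^ i * (of_nat N * of_nat (L - i)))"
    using N by (intro sum.mono_neutral_left) (auto simp: coeff_eq_0)
  also have "\<dots> = (\<Sum>i<L. coeff G i * z ^ i * (of_nat N * of_nat (L - i)))"
    by (intro sum.mono_neutral_right) (auto simp: N_def)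
  also have "\<dots> = of_nat N * of_nat L * (\<Sum>i<L. of_real (real (L - i) / real L) * coeff G i * z ^ i)"
    unfolding sum_distrib_left using \<open>0 < L\<close> by (intro sum.cong) auto
  finally have "real N * real L * norm (\<Sum>i<L. of_real (real (L - i) / real L) * coeff G i * z ^ i)
      = norm (\<Sum>k<N. poly G (z * uroot N k) * of_real (K k))"
    by (simp add: norm_mult)
  also have "\<dots> \<le> (\<Sum>k<N. 1 * K k)"
    unfolding K_def norm_mult norm_of_real
    by (intro sum_norm_le) (auto simp: norm_mult norm_power z intro!: mult_left_le_one_le G)
  also have "\<dots> = real N * real L"
  proof -
    have "complex_of_real (\<Sum>k<N. K k) = of_real (real N * real L)"
      using kernel[of 0] by simp
    then show ?thesis by (simp only: of_real_eq_iff mult_1)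
  qed
  finally have "real N * real L * norm (\<Sum>i<L. of_real (real (L - i) / real L) * coeff G i * z ^ i) \<le> real N * real L * 1"
    by simp
  then show ?thesis
    using N \<open>0 < L\<close> by (subst (asm) mult_le_cancel_left_pos) auto
qed

text \<open>The Fejer weight is at least 1/2 where \<open>2 * i \<le> L\<close>, so passing to the
  mean at most doubles the constant 24. Cutting the data off outside this range makes the original
  polynomial large exactly there.\<close>

lemma exists_short_poly_large_coeffs_lower_half:
  fixes lam :: "nat \<Rightarrow> real"
  assumes "0 < L"
  shows "\<exists>q :: nat \<Rightarrow> complex. (\<forall>z. norm z = 1 \<longrightarrow> norm (\<Sum>i<L. q i * z ^ i) \<le> 1) \<and>
     sqrt (\<Sum>i | i < L \<and> 2 * i \<le> L. (lam i)\<^sup>2) / 48 \<le> (\<Sum>i<L. \<bar>lam i\<bar> * norm (q i))"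
proof -
  define lam' where "lam' i = (if 2 * i \<le> L then lam i else 0)" for i
  obtain G :: "complex poly" where G: "\<And>z. norm z = 1 \<Longrightarrow> norm (poly G z) \<le> 1"
    "sqrt (\<Sum>i<L. (lam' i)\<^sup>2) / 24 \<le> (\<Sum>i<L. \<bar>lam' i\<bar> * norm (coeff G i))"
    using exists_poly_large_coeffs[of lam' L] by blast
  define q where "q i = of_real (real (L - i) / real L) * coeff G i" for i
  have "(\<Sum>i | i < L \<and> 2 * i \<le> L. (lam i)\<^sup>2) = (\<Sum>i<L. (lam' i)\<^sup>2)"
    by (intro sum.mono_neutral_cong_left) (auto simp: lam'_def)
  then have "sqrt (\<Sum>i | i < L \<and> 2 * i \<le> L. (lam i)\<^sup>2) / 24 \<le> (\<Sum>i<L. \<bar>lam' i\<bar> * norm (coeff G i))"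
    using G(2) by simp
  also have "\<dots> \<le> (\<Sum>i<L. 2 * (\<bar>lam i\<bar> * norm (q i)))"
  proof (intro sum_mono)
    fix i assume "i \<in> {..<L}"
    show "\<bar>lam' i\<bar> * norm (coeff G i) \<le> 2 * (\<bar>lam i\<bar> * norm (q i))"
    proof (cases "2 * i \<le> L")
      case True
      then have "1 \<le> 2 * (real (L - i) / real L)" using assms by (simp add: of_nat_diff field_simps)
      then have *: "1 * (\<bar>lam i\<bar> * norm (coeff G i)) \<le> 2 * (real (L - i) / real L) * (\<bar>lam i\<bar> * norm (coeff G i))"
        by (rule mult_right_mono) auto
      have nq: "norm (q i) = real (L - i) / real L * norm (coeff G i)"
        unfolding q_def norm_mult norm_of_real by simp
      show ?thesis using * True unfolding nq by (simp add: lam'_def mult_ac del: of_nat_diff)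
    qed (simp add: lam'_def)
  qed
  finally have "sqrt (\<Sum>i | i < L \<and> 2 * i \<le> L. (lam i)\<^sup>2) / 48 \<le> (\<Sum>i<L. \<bar>lam i\<bar> * norm (q i))"
    by (simp flip: sum_distrib_left)
  moreover have "norm (\<Sum>i<L. q i * z ^ i) \<le> 1" if "norm z = 1" for z
    unfolding q_def by (rule norm_Fejer_mean_le[OF G(1) assms that])
  ultimately show ?thesis by blast
qed

text \<open>Reversal of coefficients preserves the modulus on the unit circle. It serves twice: to
  exchange the halves of a block, and to carry the maximum principle to the exterior of the
  disc.\<close>

lemma sum_power_reflect:
  fixes z :: "'a::field"
  assumes "z \<noteq> 0"
  shows "(\<Sum>i<L. q i * z ^ i) = z ^ (L - 1) * (\<Sum>i<L. q (L - 1 - i) * inverse z ^ i)"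
proof -
  have reindex: "(\<Sum>i<L. q (L - 1 - i) * inverse z ^ i) = (\<Sum>i<L. q i * inverse z ^ (L - 1 - i))"
    by (rule sum.reindex_bij_witness[of _ "\<lambda>i. L - 1 - i" "\<lambda>i. L - 1 - i"]) auto
  have summand: "z ^ (L - 1) * (q i * inverse z ^ (L - 1 - i)) = q i * z ^ i" if "i < L" for i
  proof -
    have "z ^ (L - 1) = z ^ (L - 1 - i) * z ^ i"
      using that by (simp flip: power_add)
    then show ?thesis using assms by (simp add: power_inverse field_simps)
  qed
  show ?thesis
    unfolding reindex sum_distrib_left by (intro sum.cong refl) (simp only: lessThan_iff summand)
qed

lemma norm_sum_power_reflect_le:
  fixes q :: "nat \<Rightarrow> complex"
  assumes "\<And>z. norm z = 1 \<Longrightarrow> norm (\<Sum>i<L. q i * z ^ i) \<le> c" and z: "norm z = 1"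
  shows "norm (\<Sum>i<L. q (L - 1 - i) * z ^ i) \<le> c"
proof -
  have "z \<noteq> 0" using z by auto
  then show ?thesis
    using sum_power_reflect[of "inverse z" q L] assms(1)[of "inverse z"] z
    by (simp add: norm_mult norm_power norm_inverse)
qed

text \<open>The Fejer weights are bounded below only on the lower half of the indices; the upper half is
  reached by reflecting the polynomial.\<close>

lemma exists_short_poly_large_coeffs:
  fixes lam :: "nat \<Rightarrow> real"
  assumes "0 < L"
  shows "\<exists>q :: nat \<Rightarrow> complex. (\<forall>z. norm z = 1 \<longrightarrow> norm (\<Sum>i<L. q i * z ^ i) \<le> 1) \<and>
     sqrt (\<Sum>i<L. (lam i)\<^sup>2) / 96 \<le> (\<Sum>i<L. \<bar>lam i\<bar> * norm (q i))"
proof -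
  define S where "S = (\<Sum>i<L. (lam i)\<^sup>2)"
  define S1 where "S1 = (\<Sum>i | i < L \<and> 2 * i \<le> L. (lam i)\<^sup>2)"
  define S2 where "S2 = (\<Sum>i | i < L \<and> L < 2 * i. (lam i)\<^sup>2)"
  have S: "S = S1 + S2"
    unfolding S_def S1_def S2_def by (subst sum.union_disjoint[symmetric]) (auto intro!: sum.cong)
  have pos: "0 \<le> S1" "0 \<le> S2" by (auto simp: S1_def S2_def intro: sum_nonneg)
  \<comment> \<open>One of the two halves carries at least half of \<open>S\<close>; the generous
    factor 4 becomes the factor 2 between 48 and 96.\<close>
  have half: "sqrt S / 96 \<le> sqrt T / 48" if "S \<le> 4 * T" for T
  proof -
    have "sqrt S \<le> sqrt (4 * T)" using that by (rule real_sqrt_le_mono)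
    then show ?thesis by (simp add: real_sqrt_mult)
  qed
  consider "S2 \<le> S1" | "S1 \<le> S2" by linarith
  then show ?thesis
  proof cases
    case 1
    obtain q where q: "\<And>z. norm z = 1 \<Longrightarrow> norm (\<Sum>i<L. q i * z ^ i :: complex) \<le> 1"
      "sqrt S1 / 48 \<le> (\<Sum>i<L. \<bar>lam i\<bar> * norm (q i))"
      using exists_short_poly_large_coeffs_lower_half[OF assms, of lam] unfolding S1_def by blast
    moreover have "sqrt S / 96 \<le> sqrt S1 / 48" using 1 S pos by (intro half) simp
    ultimately show ?thesis unfolding S_def by (meson order_trans)
  next
    case 2
    define lam' where "lam' i = lam (L - 1 - i)" for i
    obtain q where q: "\<And>z. norm z = 1 \<Longrightarrow> norm (\<Sum>i<L. q i * z ^ i :: complex) \<le> 1"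
      "sqrt (\<Sum>i | i < L \<and> 2 * i \<le> L. (lam' i)\<^sup>2) / 48 \<le> (\<Sum>i<L. \<bar>lam' i\<bar> * norm (q i))"
      using exists_short_poly_large_coeffs_lower_half[OF assms, of lam'] by blast
    \<comment> \<open>Reflection sends indices with \<open>L < 2 * i\<close> into the range
      \<open>2 * i \<le> L\<close>.\<close>
    have "S2 = (\<Sum>i\<in>(\<lambda>i. L - 1 - i) ` {i. i < L \<and> L < 2 * i}. (lam' i)\<^sup>2)"
      unfolding S2_def by (subst sum.reindex) (auto simp: inj_on_def lam'_def intro!: sum.cong)
    also have "\<dots> \<le> (\<Sum>i | i < L \<and> 2 * i \<le> L. (lam' i)\<^sup>2)"
      by (intro sum_mono2) auto
    finally have "sqrt S / 96 \<le> sqrt (\<Sum>i | i < L \<and> 2 * i \<le> L. (lam' i)\<^sup>2) / 48"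
      using 2 S pos by (intro half) simp
    also note q(2)
    also have "(\<Sum>i<L. \<bar>lam' i\<bar> * norm (q i)) = (\<Sum>i<L. \<bar>lam i\<bar> * norm (q (L - 1 - i)))"
      by (rule sum.reindex_bij_witness[of _ "\<lambda>i. L - 1 - i" "\<lambda>i. L - 1 - i"]) (auto simp: lam'_def)
    finally have "sqrt S / 96 \<le> (\<Sum>i<L. \<bar>lam i\<bar> * norm (q (L - 1 - i)))" .
    moreover have "norm (\<Sum>i<L. q (L - 1 - i) * z ^ i) \<le> 1" if z: "norm z = 1" for z
      using q(1) z by (rule norm_sum_power_reflect_le)
    ultimately show ?thesis unfolding S_def by (intro exI[of _ "\<lambda>i. q (L - 1 - i)"]) auto
  qed
qed

subsection \<open>Inequalities between power sums\<close>

text \<open>Convexity of the power function, obtained from Young's inequality with exponents p and p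
  / (p - 1). The case p = 1 is separate because the conjugate exponent degenerates.\<close>

lemma powr_ge_tangent:
  fixes p x t :: real
  assumes "1 \<le> p" "0 \<le> x" "0 \<le> t"
  shows "p * (t powr (p - 1) * x) - (p - 1) * t powr p \<le> x powr p"
proof (cases "p = 1")
  case True
  then show ?thesis using assms by (cases "t = 0") auto
next
  case False
  with assms have p: "1 < p" by simp
  have "x * t powr (p - 1) \<le> x powr p / p + (t powr (p - 1)) powr (p / (p - 1)) / (p / (p - 1))"
    using p assms by (intro Youngs_inequality) (auto simp: divide_simps)
  also have "(t powr (p - 1)) powr (p / (p - 1)) = t powr p"
    using p by (simp add: powr_powr)
  finally have "p * (x * t powr (p - 1)) \<le> p * (x powr p / p + t powr p / (p / (p - 1)))"
    using p by (intro mult_left_mono) auto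
  also have "\<dots> = x powr p + (p - 1) * t powr p"
    using p by (simp add: field_simps)
  finally show ?thesis by (simp add: mult.commute)
qed

text \<open>The tangent at \<open>\<kappa> \<mu>\<^sub>i powr (r / p)\<close> turns the bound for weighted sums of \<open>|q\<^sub>i|\<close> into one for
  sums of \<open>p\<close>-th powers.\<close>

lemma exists_short_poly_large_coeffs_powr:
  fixes \<mu> :: "nat \<Rightarrow> real" and p :: real
  assumes "0 < L" "1 \<le> p" "p < 2" and r: "r = 2 * p / (2 - p)" and \<mu>: "\<And>i. 0 \<le> \<mu> i"
  shows "\<exists>q :: nat \<Rightarrow> complex. (\<forall>z. norm z = 1 \<longrightarrow> norm (\<Sum>i<L. q i * z ^ i) \<le> 1) \<and>
     (1 / 96) powr p * (\<Sum>i<L. \<mu> i powr r) powr (p / r) \<le> (\<Sum>i<L. (\<mu> i * norm (q i)) powr p)"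
proof -
  define S where "S = (\<Sum>i<L. \<mu> i powr r)"
  have S0: "0 \<le> S" by (simp add: S_def sum_nonneg)
  have r0: "0 < r" and pr: "p / r = 1 - p / 2" unfolding r using assms(2,3) by (auto simp: field_simps)
  \<comment> \<open>The weights \<open>\<mu> i powr (r / 2)\<close> have squares summing to
    \<open>S\<close>.\<close>
  obtain q :: "nat \<Rightarrow> complex" where q: "\<And>z. norm z = 1 \<Longrightarrow> norm (\<Sum>i<L. q i * z ^ i) \<le> 1"
    "sqrt (\<Sum>i<L. (\<mu> i powr (r / 2))\<^sup>2) / 96 \<le> (\<Sum>i<L. \<bar>\<mu> i powr (r / 2)\<bar> * norm (q i))"
    using exists_short_poly_large_coeffs[OF assms(1), of "\<lambda>i. \<mu> i powr (r / 2)"] by blast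
  have "(\<Sum>i<L. (\<mu> i powr (r / 2))\<^sup>2) = S"
    unfolding S_def by (intro sum.cong) (auto simp: power2_eq_square simp flip: powr_add)
  with q(2) have qS: "sqrt S / 96 \<le> (\<Sum>i<L. \<mu> i powr (r / 2) * norm (q i))" by simp
  have "(1 / 96) powr p * S powr (p / r) \<le> (\<Sum>i<L. (\<mu> i * norm (q i)) powr p)"
  proof (cases "S = 0")
    case True
    then show ?thesis by (simp add: sum_nonneg)
  next
    case False
    with S0 have S: "0 < S" by simp
    \<comment> \<open>Chosen so that \<open>\<kappa> * S = sqrt S / 96\<close>, the lower bound for
      the weighted sum. Summing the tangent inequalities then leaves
      \<open>\<kappa> powr p * S\<close>, which is the required power of \<open>S\<close>.\<close>
    define \<kappa> where "\<kappa> = 1 / 96 * S powr (- 1 / 2)"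
    have \<kappa>: "0 < \<kappa>" using S by (simp add: \<kappa>_def)
    have \<kappa>S: "\<kappa> * S = sqrt S / 96"
      using S by (simp add: \<kappa>_def powr_minus_divide powr_half_sqrt real_div_sqrt)
    have kp: "\<kappa> powr p = \<kappa> powr (p - 1) * \<kappa>"
      using \<kappa> by (metis diff_add_cancel powr_add powr_one less_imp_le)
    have pointwise: "p * \<kappa> powr (p - 1) * (\<mu> i powr (r / 2) * norm (q i)) - (p - 1) * \<kappa> powr p * \<mu> i powr r
        \<le> (\<mu> i * norm (q i)) powr p" for i
    proof (cases "\<mu> i = 0")
      case True
      then show ?thesis by simp
    next
      case False
      with \<mu>[of i] have m: "0 < \<mu> i" by simp
      have e: "r / p * (p - 1) + 1 = r / 2" using assms by (simp add: r field_simps)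
      have "(\<kappa> * \<mu> i powr (r / p)) powr (p - 1) * (\<mu> i * norm (q i))
          = \<kappa> powr (p - 1) * (\<mu> i powr (r / p * (p - 1)) * \<mu> i powr 1 * norm (q i))"
        using m \<kappa> by (simp add: powr_mult powr_powr)
      also have "\<dots> = \<kappa> powr (p - 1) * (\<mu> i powr (r / 2) * norm (q i))"
        unfolding powr_add[symmetric] e ..
      finally have 1: "(\<kappa> * \<mu> i powr (r / p)) powr (p - 1) * (\<mu> i * norm (q i)) = \<dots>" .
      have 2: "(\<kappa> * \<mu> i powr (r / p)) powr p = \<kappa> powr p * \<mu> i powr r"
        using m \<kappa> assms by (simp add: powr_mult powr_powr)
      show ?thesis
        using powr_ge_tangent[OF assms(2), of "\<mu> i * norm (q i)" "\<kappa> * \<mu> i powr (r / p)"] m \<kappa>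
        unfolding 1 2 by (simp add: mult.assoc)
    qed
    have "\<kappa> powr p * S = (1 / 96) powr p * (S powr (- p / 2) * S powr 1)"
      using S by (simp add: \<kappa>_def powr_mult powr_divide powr_powr)
    also have "\<dots> = (1 / 96) powr p * S powr (p / r)"
      unfolding powr_add[symmetric] by (simp add: pr)
    finally have "(1 / 96) powr p * S powr (p / r) = \<kappa> powr p * S" ..
    also have "\<dots> = p * \<kappa> powr (p - 1) * (\<kappa> * S) - (p - 1) * \<kappa> powr p * S"
      unfolding kp by (simp add: algebra_simps)
    also have "\<dots> \<le> p * \<kappa> powr (p - 1) * (\<Sum>i<L. \<mu> i powr (r / 2) * norm (q i)) - (p - 1) * \<kappa> powr p * S"
      unfolding \<kappa>S using qS assms by (intro diff_mono mult_left_mono) auto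
    also have "\<dots> = (\<Sum>i<L. p * \<kappa> powr (p - 1) * (\<mu> i powr (r / 2) * norm (q i)) - (p - 1) * \<kappa> powr p * \<mu> i powr r)"
      by (simp add: sum_subtractf S_def flip: sum_distrib_left)
    also have "\<dots> \<le> (\<Sum>i<L. (\<mu> i * norm (q i)) powr p)"
      by (intro sum_mono pointwise)
    finally show ?thesis .
  qed
  then show ?thesis using q(1) unfolding S_def by blast
qed

section \<open>Hoelder type upper bounds on one block\<close>

text \<open>Hoelder's inequality with exponents 2 / (2 - p) and 2 / p, proved by the weighted mean
  inequality for the normalized terms \<open>\<mu> i powr r / S\<close> and
  \<open>(\<alpha> i)\<^sup>2 / M\<^sup>2\<close>, with weights 1 - p/2 and p/2.\<close>

lemma sum_powr_mult_le_small_exponent: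
  fixes \<mu> \<alpha> :: "nat \<Rightarrow> real" and p :: real
  assumes "1 \<le> p" "p < 2" and r: "r = 2 * p / (2 - p)"
    and \<mu>: "\<And>i. 0 \<le> \<mu> i" and \<alpha>: "\<And>i. 0 \<le> \<alpha> i"
    and M: "0 < M" "(\<Sum>i\<in>I. (\<alpha> i)\<^sup>2) \<le> M\<^sup>2" and "finite I"
  shows "(\<Sum>i\<in>I. (\<mu> i * \<alpha> i) powr p) \<le> (\<Sum>i\<in>I. \<mu> i powr r) powr (p / r) * M powr p"
proof -
  define S where "S = (\<Sum>i\<in>I. \<mu> i powr r)"
  have S0: "0 \<le> S" by (simp add: S_def sum_nonneg)
  have pr: "p / r = 1 - p / 2" and rpr: "r * (1 - p / 2) = p" and r0: "0 < r"
    unfolding r using assms(1,2) by (auto simp: field_simps)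
  show ?thesis
  proof (cases "S = 0")
    case True
    then have "\<mu> i = 0" if "i \<in> I" for i
      using that \<open>finite I\<close> by (subst (asm) S_def, subst (asm) sum_nonneg_eq_0_iff) auto
    then show ?thesis by simp
  next
    case False
    with S0 have S: "0 < S" by simp
    have pointwise: "(\<mu> i * \<alpha> i) powr p \<le> S powr (p / r) * M powr p *
        ((1 - p / 2) * (\<mu> i powr r / S) + p / 2 * ((\<alpha> i)\<^sup>2 / M\<^sup>2))" for i
    proof (cases "\<mu> i = 0 \<or> \<alpha> i = 0")
      case True
      have "0 \<le> (1 - p / 2) * (\<mu> i powr r / S) + p / 2 * ((\<alpha> i)\<^sup>2 / M\<^sup>2)"
        using assms S by (intro add_nonneg_nonneg mult_nonneg_nonneg) auto
      then have "0 \<le> S powr (p / r) * M powr p *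
          ((1 - p / 2) * (\<mu> i powr r / S) + p / 2 * ((\<alpha> i)\<^sup>2 / M\<^sup>2))"
        by (intro mult_nonneg_nonneg) auto
      moreover have "(\<mu> i * \<alpha> i) powr p = 0" using True by auto
      ultimately show ?thesis by linarith
    next
      case False
      with \<mu>[of i] \<alpha>[of i] have pos: "0 < \<mu> i" "0 < \<alpha> i" by auto
      have "(\<mu> i powr r / S) powr (1 - p / 2) * ((\<alpha> i)\<^sup>2 / M\<^sup>2) powr (p / 2)
          \<le> (1 - p / 2) * (\<mu> i powr r / S) + p / 2 * ((\<alpha> i)\<^sup>2 / M\<^sup>2)"
        using assms S pos by (intro Youngs_inequality_0) auto
      moreover have "(\<mu> i powr r / S) powr (1 - p / 2) = \<mu> i powr p / S powr (p / r)"
        using pos S by (simp add: powr_divide powr_powr rpr pr)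
      moreover have "((\<alpha> i)\<^sup>2 / M\<^sup>2) powr (p / 2) = \<alpha> i powr p / M powr p"
        using pos M(1) by (simp add: powr_divide powr_powr flip: powr_numeral)
      ultimately have "\<mu> i powr p / S powr (p / r) * (\<alpha> i powr p / M powr p)
          \<le> (1 - p / 2) * (\<mu> i powr r / S) + p / 2 * ((\<alpha> i)\<^sup>2 / M\<^sup>2)" by simp
      then have "S powr (p / r) * M powr p * (\<mu> i powr p / S powr (p / r) * (\<alpha> i powr p / M powr p))
          \<le> S powr (p / r) * M powr p * ((1 - p / 2) * (\<mu> i powr r / S) + p / 2 * ((\<alpha> i)\<^sup>2 / M\<^sup>2))"
        by (rule mult_left_mono) auto
      then show ?thesis using S M(1) pos by (simp add: powr_mult)
    qed
    have "(\<Sum>i\<in>I. (\<mu> i * \<alpha> i) powr p) \<le> (\<Sum>i\<in>I. S powr (p / r) * M powr p *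
        ((1 - p / 2) * (\<mu> i powr r / S) + p / 2 * ((\<alpha> i)\<^sup>2 / M\<^sup>2)))"
      by (intro sum_mono pointwise)
    also have "\<dots> = S powr (p / r) * M powr p *
        ((1 - p / 2) * ((\<Sum>i\<in>I. \<mu> i powr r) / S) + p / 2 * ((\<Sum>i\<in>I. (\<alpha> i)\<^sup>2) / M\<^sup>2))"
      by (simp only: sum_distrib_left[symmetric] sum.distrib sum_divide_distrib[symmetric])
    also have "(\<Sum>i\<in>I. \<mu> i powr r) / S = 1" using S by (simp add: S_def)
    also have "S powr (p / r) * M powr p *
        ((1 - p / 2) * 1 + p / 2 * ((\<Sum>i\<in>I. (\<alpha> i)\<^sup>2) / M\<^sup>2))
      \<le> S powr (p / r) * M powr p * ((1 - p / 2) * 1 + p / 2 * 1)"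
      using assms S by (intro mult_left_mono add_mono) auto
    also have "\<dots> = S powr (p / r) * M powr p" by simp
    finally show ?thesis by (simp add: S_def)
  qed
qed

text \<open>Each \<open>\<alpha> i / M\<close> is at most 1, so its p-th power is below its square;
  for \<mu> only the supremum is then needed.\<close>

lemma sum_powr_mult_le_large_exponent:
  fixes \<mu> \<alpha> :: "nat \<Rightarrow> real" and p :: real
  assumes "2 \<le> p" and \<mu>: "\<And>i. i \<in> I \<Longrightarrow> 0 \<le> \<mu> i \<and> \<mu> i \<le> X" and \<alpha>: "\<And>i. 0 \<le> \<alpha> i"
    and M: "0 < M" "(\<Sum>i\<in>I. (\<alpha> i)\<^sup>2) \<le> M\<^sup>2" and "finite I"
  shows "(\<Sum>i\<in>I. (\<mu> i * \<alpha> i) powr p) \<le> X powr p * M powr p"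
proof -
  have "(\<mu> i * \<alpha> i) powr p \<le> X powr p * M powr p * ((\<alpha> i)\<^sup>2 / M\<^sup>2)" if "i \<in> I" for i
  proof -
    have "(\<alpha> i)\<^sup>2 \<le> (\<Sum>i\<in>I. (\<alpha> i)\<^sup>2)"
      using that \<open>finite I\<close> by (intro member_le_sum) auto
    with M(2) have "(\<alpha> i)\<^sup>2 \<le> M\<^sup>2" by linarith
    then have le: "\<alpha> i / M \<le> 1" using M(1) \<alpha>[of i] by (simp add: power2_le_iff_abs_le)
    have "(\<alpha> i / M) powr p \<le> (\<alpha> i / M) powr 2"
      using le assms(1) \<alpha>[of i] M(1) by (intro powr_mono') auto
    also have "\<dots> = (\<alpha> i)\<^sup>2 / M\<^sup>2"
      using M(1) \<alpha>[of i] by (simp add: power_divide)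
    finally have *: "(\<alpha> i / M) powr p \<le> (\<alpha> i)\<^sup>2 / M\<^sup>2" .
    have "(\<mu> i * \<alpha> i) powr p = \<mu> i powr p * (M powr p * (\<alpha> i / M) powr p)"
      using M(1) \<alpha>[of i] \<mu>[OF that] by (simp add: powr_mult powr_divide)
    also have "\<dots> \<le> X powr p * (M powr p * ((\<alpha> i)\<^sup>2 / M\<^sup>2))"
      using * \<mu>[OF that] assms(1) by (intro mult_mono powr_mono2 mult_left_mono) auto
    finally show ?thesis by (simp add: mult.assoc)
  qed
  then have "(\<Sum>i\<in>I. (\<mu> i * \<alpha> i) powr p) \<le> (\<Sum>i\<in>I. X powr p * M powr p * ((\<alpha> i)\<^sup>2 / M\<^sup>2))"
    by (rule sum_mono)
  also have "\<dots> = X powr p * M powr p * ((\<Sum>i\<in>I. (\<alpha> i)\<^sup>2) / M\<^sup>2)"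
    by (simp add: sum_distrib_left sum_divide_distrib)
  also have "\<dots> \<le> X powr p * M powr p * 1"
    using M by (intro mult_left_mono) auto
  finally show ?thesis by simp
qed

subsection \<open>Growth and coefficients of entire functions\<close>

lemma norm_poly_sum_le_inside:
  fixes q :: "nat \<Rightarrow> complex"
  assumes q: "\<And>z. norm z = 1 \<Longrightarrow> norm (\<Sum>i<L. q i * z ^ i) \<le> 1" and z: "norm z \<le> 1"
  shows "norm (\<Sum>i<L. q i * z ^ i) \<le> 1"
proof (rule maximum_modulus_frontier[of "\<lambda>z. \<Sum>i<L. q i * z ^ i" "cball 0 1"])
  show "norm (\<Sum>i<L. q i * w ^ i) \<le> 1" if "w \<in> frontier (cball 0 1)" for w
    using that q[of w] by simp
qed (use z in \<open>auto intro!: holomorphic_intros continuous_intros\<close>)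

text \<open>The maximum principle applied to the reversed polynomial at
  \<open>inverse z\<close>.\<close>

lemma norm_poly_sum_le_outside:
  fixes q :: "nat \<Rightarrow> complex"
  assumes q: "\<And>z. norm z = 1 \<Longrightarrow> norm (\<Sum>i<L. q i * z ^ i) \<le> 1" and z: "1 \<le> norm z"
  shows "norm (\<Sum>i<L. q i * z ^ i) \<le> norm z ^ (L - 1)"
proof -
  have "norm (\<Sum>i<L. q (L - 1 - i) * w ^ i) \<le> 1" if "norm w = 1" for w
    using q that by (rule norm_sum_power_reflect_le)
  then have "norm (\<Sum>i<L. q (L - 1 - i) * inverse z ^ i) \<le> 1"
    by (rule norm_poly_sum_le_inside) (use z in \<open>auto simp: norm_inverse inverse_le_1_iff\<close>)
  moreover have "z \<noteq> 0" using z by auto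
  ultimately show ?thesis
    using mult_left_mono[of "norm (\<Sum>i<L. q (L - 1 - i) * inverse z ^ i)" 1 "norm z ^ (L - 1)"]
    by (simp add: sum_power_reflect[of z] norm_mult norm_power)
qed

lemma sum_norm_power2_le_of_circle_bound:
  fixes q :: "nat \<Rightarrow> complex"
  assumes q: "\<And>z. norm z = 1 \<Longrightarrow> norm (\<Sum>i<L. q i * z ^ i) \<le> c"
  shows "(\<Sum>i<L. (norm (q i))\<^sup>2) \<le> c\<^sup>2"
proof (cases "L = 0")
  case False
  define P where "P = Poly (map q [0..<L])"
  have cP: "coeff P i = (if i < L then q i else 0)" for i
    by (simp add: P_def nth_default_def)
  have deg: "degree P < L"
    using False by (intro le_less_trans[OF degree_le[of "L - 1"]]) (auto simp: cP)
  have "real L * (\<Sum>i<L. (norm (q i))\<^sup>2) = (\<Sum>k<L. (norm (poly P (uroot L k)))\<^sup>2)"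
    unfolding discrete_Parseval_norm[OF deg] by (simp add: cP)
  also have "\<dots> \<le> (\<Sum>k<L. c\<^sup>2)"
    using q unfolding poly_eq_sum_lessThan[OF deg] by (intro sum_mono power_mono) (auto simp: cP)
  finally have "real L * (\<Sum>i<L. (norm (q i))\<^sup>2) \<le> real L * c\<^sup>2" by simp
  then show ?thesis using False by (subst (asm) mult_le_cancel_left_pos) auto
qed auto

text \<open>Taylor polynomials converge uniformly on each circle, so the discrete Parseval bound for
  them passes to the limit. One \<open>M\<close> serves all radii, which is what makes the bound
  uniform over the blocks.\<close>

lemma H_inf_seq_Parseval:
  assumes v: "\<And>r. 0 \<le> r \<Longrightarrow> 0 < v r" and a: "a \<in> H_inf_seq v"
  obtains M where "0 < M"
    "\<And>r I. 0 \<le> r \<Longrightarrow> finite I \<Longrightarrow> (\<Sum>m\<in>I. (v r * r ^ m * norm (a m))\<^sup>2) \<le> M\<^sup>2"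
proof -
  obtain f where f: "f \<in> H_inf v" and sums: "\<And>z. (\<lambda>m. a m * z ^ m) sums f z"
    using a by (auto simp: H_inf_seq_def)
  obtain M0 where M0: "\<And>z. v (norm z) * norm (f z) \<le> M0"
    using f by (auto simp: H_inf_def bdd_above_def)
  define M where "M = max M0 1"
  have M: "0 < M" "\<And>z. v (norm z) * norm (f z) \<le> M"
    using M0 by (auto simp: M_def intro: le_max_iff_disj[THEN iffD2])
  moreover have "(\<Sum>m\<in>I. (v r * r ^ m * norm (a m))\<^sup>2) \<le> M\<^sup>2" if r: "0 \<le> r" and I: "finite I" for r I
  proof -
    define X where "X = (\<Sum>m\<in>I. (r ^ m * norm (a m))\<^sup>2)"
    have X0: "0 \<le> X" by (auto simp: X_def intro: sum_nonneg)
    have "sqrt X \<le> M / v r + \<delta>" if "0 < \<delta>" for \<delta>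
    proof -
      \<comment> \<open>Convergence at the larger radius \<open>r + 1\<close> gives absolute
        convergence at \<open>r\<close>, as the Weierstrass test requires.\<close>
      have "summable (\<lambda>m. a m * of_real (r + 1) ^ m)" using sums by (rule sums_summable)
      from powser_insidea[OF this, of "of_real r"] r
      have "summable (\<lambda>m. norm (a m) * r ^ m)" by (simp add: norm_mult norm_power)
      then have "uniform_limit (sphere 0 r) (\<lambda>n z. \<Sum>m<n. a m * z ^ m) (\<lambda>z. \<Sum>m. a m * z ^ m) sequentially"
        by (rule Weierstrass_m_test[rotated]) (auto simp: norm_mult norm_power)
      moreover have "(\<Sum>m. a m * z ^ m) = f z" for z
        using sums_unique[OF sums] by simp
      ultimately have "\<forall>\<^sub>F n in sequentially. \<forall>z\<in>sphere 0 r. dist (\<Sum>m<n. a m * z ^ m) (f z) < \<delta>"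
        using that by (simp add: uniform_limit_iff)
      from eventually_conj[OF eventually_ge_at_top[of "Suc (Max (insert 0 I))"] this]
      have "\<exists>n. Suc (Max (insert 0 I)) \<le> n \<and> (\<forall>z\<in>sphere 0 r. dist (\<Sum>m<n. a m * z ^ m) (f z) < \<delta>)"
        by (rule eventually_happens'[OF sequentially_bot])
      then obtain n where n: "Suc (Max (insert 0 I)) \<le> n"
        "\<And>z. norm z = r \<Longrightarrow> dist (\<Sum>m<n. a m * z ^ m) (f z) < \<delta>"
        by auto
      have sub: "I \<subseteq> {..<n}"
      proof
        fix m assume "m \<in> I"
        then have "m \<le> Max (insert 0 I)" using I by auto
        then show "m \<in> {..<n}" using n(1) by simp
      qed
      have "norm (\<Sum>m<n. (a m * of_real r ^ m) * z ^ m) \<le> M / v r + \<delta>" if z: "norm z = 1" for z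
      proof -
        have nz: "norm (of_real r * z) = r" using r z by (simp add: norm_mult)
        have "norm (\<Sum>m<n. a m * (of_real r * z) ^ m) \<le> norm (f (of_real r * z)) + \<delta>"
          using n(2)[OF nz] norm_triangle_sub[of "\<Sum>m<n. a m * (of_real r * z) ^ m" "f (of_real r * z)"]
          by (simp add: dist_norm)
        also have "norm (f (of_real r * z)) \<le> M / v r"
          using M(2)[of "of_real r * z"] v[OF r] nz by (simp add: field_simps)
        finally show ?thesis by (simp add: power_mult_distrib mult_ac)
      qed
      from sum_norm_power2_le_of_circle_bound[OF this]
      have "(\<Sum>m<n. (norm (a m * of_real r ^ m))\<^sup>2) \<le> (M / v r + \<delta>)\<^sup>2" .
      moreover have "X \<le> (\<Sum>m<n. (norm (a m * of_real r ^ m))\<^sup>2)"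
        unfolding X_def using sub r
        by (subst sum.cong[OF refl, of I _ "\<lambda>m. (norm (a m * of_real r ^ m))\<^sup>2"])
           (auto simp: norm_mult norm_power mult_ac intro!: sum_mono2)
      ultimately have "X \<le> (M / v r + \<delta>)\<^sup>2" by linarith
      then show ?thesis
        using M(1) v[OF r] that by (intro real_le_lsqrt) (auto intro!: add_nonneg_nonneg)
    qed
    then have "sqrt X \<le> M / v r" by (rule field_le_epsilon)
    then have "v r * sqrt X \<le> M" using v[OF r] by (simp add: field_simps)
    then have "(v r * sqrt X)\<^sup>2 \<le> M\<^sup>2"
      using v[OF r] X0 by (intro power_mono) auto
    then have "(v r)\<^sup>2 * X \<le> M\<^sup>2" using X0 by (simp add: power_mult_distrib)
    then show ?thesis by (simp add: X_def sum_distrib_left power_mult_distrib mult_ac)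
  qed
  ultimately show ?thesis using that by blast
qed

subsection \<open>Weights with lacunary blocks\<close>

locale weight_blocks =
  fixes v \<rho> :: "real \<Rightarrow> real" and J :: "nat \<Rightarrow> nat" and b K :: real
  assumes weight: "weight v" and max_points: "max_points v \<rho>"
    and strict_mono: "strict_mono J" and J_pos: "\<And>n. 0 < J n"
    and b: "1 < b"
    and A_ge: "\<And>n. b \<le> A v \<rho> (J n) (J (Suc n))"
    and B_ge: "\<And>n. b \<le> B v \<rho> (J n) (J (Suc n))"
    and B_le: "\<And>n. B v \<rho> (J n) (J (Suc n)) \<le> K"
begin

section \<open>The radii of maximal growth\<close>

definition R :: "nat \<Rightarrow> real" where "R n = \<rho> (real (J n))"

lemma v_pos: "0 \<le> r \<Longrightarrow> 0 < v r"
  using weight by (simp add: weight_def)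

lemma R_pos: "0 < R n" and R_max: "0 \<le> r \<Longrightarrow> r ^ J n * v r \<le> R n ^ J n * v (R n)"
proof -
  have J0: "0 < real (J n)" using J_pos by simp
  have nonneg: "0 \<le> R n" and le: "\<And>r. 0 \<le> r \<Longrightarrow> r powr real (J n) * v r \<le> R n powr real (J n) * v (R n)"
    using max_points J0 unfolding max_points_def R_def by blast+
  \<comment> \<open>Comparison with the positive value at radius 1 shows that the maximum point is
    not 0.\<close>
  have "0 < R n powr real (J n) * v (R n)"
    using le[of 1] v_pos[of 1] by simp
  then show pos: "0 < R n" using nonneg by (cases "R n = 0") auto
  show "r ^ J n * v r \<le> R n ^ J n * v (R n)" if "0 \<le> r"
    using le[OF that] pos that J_pos[of n] by (cases "r = 0") (auto simp: powr_realpow zero_power v_pos less_imp_le)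
qed

lemma vR_pos: "0 < v (R n)"
  using R_pos[of n] v_pos by simp

lemma A_ge': "b \<le> (R n / R (Suc n)) ^ J n * (v (R n) / v (R (Suc n)))"
  and B_ge': "b \<le> (R (Suc n) / R n) ^ J (Suc n) * (v (R (Suc n)) / v (R n))"
  and B_le': "(R (Suc n) / R n) ^ J (Suc n) * (v (R (Suc n)) / v (R n)) \<le> K"
  using A_ge[of n] B_ge[of n] B_le[of n] R_pos[of n] R_pos[of "Suc n"]
  unfolding A_def B_def by (auto simp: powr_realpow simp flip: R_def)

lemma K_pos: "0 < K"
  using b B_ge[of 0] B_le[of 0] by linarith

lemma J_less_Suc: "J n < J (Suc n)"
  using strict_mono by (simp add: strict_mono_Suc_iff)

lemma le_J: "n \<le> J n"
  using strict_mono by (rule strict_mono_imp_increasing)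

lemma J_mono: "m \<le> n \<Longrightarrow> J m \<le> J n"
  using strict_mono by (simp add: strict_mono_less_eq)

text \<open>In the product of the two quantities \<open>A\<close> and \<open>B\<close> the values of
  \<open>v\<close> cancel, leaving the power \<open>J (Suc n) - J n\<close> of
  \<open>R (Suc n) / R n\<close>; this product exceeds 1.\<close>

lemma R_less_Suc: "R n < R (Suc n)"
proof (rule ccontr)
  assume "\<not> R n < R (Suc n)"
  then have x: "R (Suc n) / R n \<le> 1" "0 < R (Suc n) / R n" using R_pos by auto
  define x where "x = R (Suc n) / R n"
  define y where "y = v (R (Suc n)) / v (R n)"
  have y: "0 < y" using vR_pos by (simp add: y_def)
  have B: "1 < x ^ J (Suc n) * y"
    using B_ge'[of n] b by (simp add: x_def y_def)
  have "1 < inverse x ^ J n * inverse y"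
    using A_ge'[of n] b by (simp add: x_def y_def)
  then have "x ^ J n * y < 1"
    using x y by (simp add: x_def[symmetric] field_simps)
  moreover have "x ^ J (Suc n) \<le> x ^ J n"
    using x J_less_Suc[of n] by (intro power_decreasing) (auto simp: x_def)
  then have "x ^ J (Suc n) * y \<le> x ^ J n * y" using y by (intro mult_right_mono) auto
  ultimately show False using B by linarith
qed

lemma R_mono: "m \<le> n \<Longrightarrow> R m \<le> R n"
  by (rule lift_Suc_mono_le) (use R_less_Suc less_imp_le in auto)

text \<open>If all radii stayed below \<open>x\<close>, maximality at \<open>R n\<close> compared
  with the point \<open>2 * x\<close> would bound \<open>2 ^ J n\<close> independently of
  \<open>n\<close>.\<close>

lemma R_unbounded: "\<exists>n. x \<le> R n"
proof (rule ccontr)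
  assume "\<not> ?thesis"
  then have less: "R n < x" for n by (auto simp: not_le)
  then have x: "0 < x" using R_pos[of 0] by (meson less_trans)
  have "2 ^ n * v (2 * x) \<le> v 0" for n
  proof -
    have "(2 * x) ^ J n * v (2 * x) \<le> R n ^ J n * v (R n)" using x by (intro R_max) auto
    also have "\<dots> \<le> x ^ J n * v 0"
    proof (intro mult_mono power_mono)
      have "antimono_on {0..} v" using weight by (simp add: weight_def)
      then show "v (R n) \<le> v 0" using R_pos[of n] by (auto simp: monotone_on_def)
    qed (use less[of n] R_pos[of n] x v_pos less_imp_le in auto)
    finally have "2 ^ J n * v (2 * x) \<le> v 0" using x by (simp add: power_mult_distrib)
    moreover have "(2::real) ^ n \<le> 2 ^ J n" using le_J by (intro power_increasing) auto
    then have "2 ^ n * v (2 * x) \<le> 2 ^ J n * v (2 * x)"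
      using v_pos[of "2 * x"] x by (intro mult_right_mono) auto
    ultimately show ?thesis by linarith
  qed
  then have "2 ^ n \<le> v 0 / v (2 * x)" for n
    using v_pos[of "2 * x"] x by (simp add: field_simps)
  moreover obtain n where "v 0 / v (2 * x) < 2 ^ n"
    using real_arch_pow[of 2 "v 0 / v (2 * x)"] by auto
  ultimately show False by (meson not_le)
qed

text \<open>\<open>E n\<close> is the weighted growth \<open>r\<^sup>m v(r)\<close> for \<open>m = J n\<close>, normalized by its maximum.\<close>

definition E :: "nat \<Rightarrow> real \<Rightarrow> real" where
  "E n r = v r * (r / R n) ^ J n / v (R n)"

lemma E_nonneg: "0 \<le> r \<Longrightarrow> 0 \<le> E n r"
  using v_pos[of r] vR_pos[of n] R_pos[of n] by (simp add: E_def)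

lemma E_le_1: "0 \<le> r \<Longrightarrow> E n r \<le> 1"
  using R_max[of r n] vR_pos[of n] R_pos[of n] by (simp add: E_def power_divide divide_simps mult_ac)

text \<open>\<open>E (Suc n) r\<close> is \<open>E n r\<close> times a positive power of
  \<open>r / R n\<close>, divided by the quantity \<open>B\<close>. To the left of
  \<open>R n\<close> that power is at most 1. To the right of \<open>R (Suc n)\<close> the quantity
  \<open>A\<close> plays the same part in the opposite direction.\<close>

lemma E_Suc_le:
  assumes "0 \<le> r" "r \<le> R n"
  shows "E (Suc n) r \<le> E n r / b"
proof -
  note pos = R_pos[of n] R_pos[of "Suc n"] vR_pos[of n] vR_pos[of "Suc n"] v_pos[OF assms(1)] b
  define B' where "B' = (R (Suc n) / R n) ^ J (Suc n) * (v (R (Suc n)) / v (R n))"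
  have B': "b \<le> B'" using B_ge' by (simp add: B'_def)
  have "E (Suc n) r = v r * (r / R n) ^ J (Suc n) / v (R n) / B'"
    using pos by (simp add: E_def B'_def power_divide)
  also have "\<dots> \<le> E n r / B'"
    unfolding E_def using pos assms B' J_less_Suc[of n]
    by (intro divide_right_mono mult_left_mono power_decreasing) auto
  also have "\<dots> \<le> E n r / b"
    using B' b E_nonneg[OF assms(1)] by (intro divide_left_mono) auto
  finally show ?thesis .
qed

lemma E_le_Suc:
  assumes "R (Suc n) \<le> r"
  shows "E n r \<le> E (Suc n) r / b"
proof -
  have r: "0 \<le> r" using assms R_pos[of "Suc n"] by linarith
  note pos = R_pos[of n] R_pos[of "Suc n"] vR_pos[of n] vR_pos[of "Suc n"] v_pos[OF r] b
  define A' where "A' = (R n / R (Suc n)) ^ J n * (v (R n) / v (R (Suc n)))"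
  have A': "b \<le> A'" using A_ge' by (simp add: A'_def)
  have "E n r = v r * (r / R (Suc n)) ^ J n / v (R (Suc n)) / A'"
    using pos by (simp add: E_def A'_def power_divide)
  also have "\<dots> \<le> E (Suc n) r / A'"
    unfolding E_def using pos assms A' J_less_Suc[of n]
    by (intro divide_right_mono mult_left_mono power_increasing) auto
  also have "\<dots> \<le> E (Suc n) r / b"
    using A' b E_nonneg[OF r] by (intro divide_left_mono) auto
  finally show ?thesis .
qed

lemma E_decay_above:
  assumes "0 \<le> r" "r \<le> R k" "k \<le> n"
  shows "E n r \<le> (1 / b) ^ (n - k)"
  using assms(3)
proof (induction n rule: dec_induct)
  case base
  then show ?case using E_le_1 assms by simp
next
  case (step n)
  have "E (Suc n) r \<le> E n r / b"
    using assms R_mono[OF step(1)] by (intro E_Suc_le) auto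
  also have "\<dots> \<le> (1 / b) ^ (n - k) / b"
    using step.IH b by (intro divide_right_mono) auto
  also have "\<dots> = (1 / b) ^ (Suc n - k)"
    using step(1) by (simp add: Suc_diff_le)
  finally show ?case .
qed

lemma E_decay_below:
  assumes "R k \<le> r" "n \<le> k"
  shows "E n r \<le> (1 / b) ^ (k - n)"
  using assms(2)
proof (induction n rule: inc_induct)
  case base
  then show ?case using E_le_1 assms R_pos[of k] by simp
next
  case (step n)
  have "E n r \<le> E (Suc n) r / b"
    using assms R_mono[of "Suc n" k] step by (intro E_le_Suc) auto
  also have "\<dots> \<le> (1 / b) ^ (k - Suc n) / b"
    using step.IH b by (intro divide_right_mono) auto
  also have "\<dots> = (1 / b) ^ (k - n)"
    using step(2) by (simp add: Suc_diff_Suc[symmetric])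
  finally show ?case .
qed

section \<open>Decomposition of the indices into blocks\<close>

lemma block_index_eq:
  assumes "m \<in> {J n<..J (Suc n)}"
  shows "block_index J m = n"
  unfolding block_index_def
proof (rule the_equality)
  fix n' assume n': "J n' < m \<and> m \<le> J (Suc n')"
  then have "J n' < J (Suc n)" "J n < J (Suc n')" using assms by auto
  then have "n' < Suc n" "n < Suc n'" using strict_mono by (auto simp: strict_mono_less)
  then show "n' = n" by simp
qed (use assms in auto)

lemma block_exists:
  assumes "J k < m"
  obtains n where "k \<le> n" "m \<in> {J n<..J (Suc n)}"
proof -
  define N where "N = (LEAST N. m \<le> J N)"
  have N: "m \<le> J N" unfolding N_def by (rule LeastI[of _ m]) (rule le_J)
  have "k < N"
    using N assms strict_mono by (metis less_le_trans strict_mono_less)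
  moreover have "J (N - 1) < m"
    using not_less_Least[of "N - 1" "\<lambda>N. m \<le> J N"] \<open>k < N\<close> by (simp add: N_def[symmetric])
  ultimately show ?thesis using N that[of "N - 1"] by auto
qed

lemma sum_blocks:
  fixes g :: "nat \<Rightarrow> 'a::comm_monoid_add"
  shows "(\<Sum>n<N. \<Sum>m\<in>{J n<..J (Suc n)}. g m) = (\<Sum>m\<in>{J 0<..J N}. g m)"
proof (induction N)
  case (Suc N)
  have "{J 0<..J (Suc N)} = {J 0<..J N} \<union> {J N<..J (Suc N)}"
    using J_mono[of 0 N] J_mono[of N "Suc N"] by auto
  then show ?case using Suc by (simp add: sum.union_disjoint)
qed simp

lemma sum_block_shift:
  "(\<Sum>m\<in>{J n<..J (Suc n)}. g m) = (\<Sum>i<J (Suc n) - J n. g (Suc (J n) + i))"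
  by (rule sum.reindex_bij_witness[of _ "\<lambda>i. Suc (J n) + i" "\<lambda>m. m - Suc (J n)"]) auto

section \<open>Synthesis of functions with prescribed blocks\<close>

text \<open>Taylor coefficients of the sum over n of f_n(z / R_n) / v(R_n), where f_n(w) is
  \<open>w ^ Suc (J n)\<close> times the polynomial with coefficients \<open>q n\<close>. No
  frequency up to \<open>J 0\<close> occurs.\<close>

definition block_coeffs :: "(nat \<Rightarrow> nat \<Rightarrow> complex) \<Rightarrow> nat \<Rightarrow> complex" where
  "block_coeffs q m = (if m \<le> J 0 then 0 else
     (let n = block_index J m in q n (m - Suc (J n)) / of_real (v (R n) * R n ^ m)))"

lemma block_coeffs_eq:
  "i < J (Suc n) - J n \<Longrightarrow>
   block_coeffs q (Suc (J n) + i) = q n i / of_real (v (R n) * R n ^ (Suc (J n) + i))"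
  using block_index_eq[of "Suc (J n) + i" n] J_mono[of 0 n] by (simp add: block_coeffs_def)

lemma weighted_coeffs_eq:
  "m \<in> {J n<..J (Suc n)} \<Longrightarrow> weighted_coeffs v \<rho> J lam m = norm (lam m) / (v (R n) * R n ^ m)"
  by (simp add: weighted_coeffs_def block_index_eq R_def inverse_eq_divide Let_def)

lemma weighted_coeffs_nonneg: "0 \<le> weighted_coeffs v \<rho> J lam m"
  using R_pos[of "block_index J m"] vR_pos[of "block_index J m"]
  by (simp add: weighted_coeffs_def Let_def flip: R_def)

lemma norm_mult_block_coeffs:
  assumes "i < J (Suc n) - J n"
  shows "norm (lam (Suc (J n) + i) * block_coeffs q (Suc (J n) + i))
       = weighted_coeffs v \<rho> J lam (Suc (J n) + i) * norm (q n i)"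
  using assms R_pos[of n] vR_pos[of n]
  by (subst weighted_coeffs_eq[of _ n])
     (auto simp: block_coeffs_eq norm_mult norm_divide norm_power simp del: add_Suc)

text \<open>Inside the radius \<open>R n\<close> the block is dominated by the power
  \<open>J n\<close>, outside it by its highest frequency \<open>J (Suc n)\<close>. Rescaling the
  latter from \<open>R n\<close> to \<open>R (Suc n)\<close> costs exactly the quantity
  \<open>B\<close>, hence the factor \<open>K\<close>.\<close>

lemma norm_block_poly_le:
  assumes q: "\<And>n z. norm z = 1 \<Longrightarrow> norm (\<Sum>i<J (Suc n) - J n. q n i * z ^ i) \<le> 1"
  shows "norm z \<le> R n \<Longrightarrow>
           v (norm z) * norm (\<Sum>m\<in>{J n<..J (Suc n)}. block_coeffs q m * z ^ m) \<le> E n (norm z)"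
    and "R n \<le> norm z \<Longrightarrow>
           v (norm z) * norm (\<Sum>m\<in>{J n<..J (Suc n)}. block_coeffs q m * z ^ m) \<le> K * E (Suc n) (norm z)"
proof -
  define L where "L = J (Suc n) - J n"
  have L: "0 < L" "Suc (J n) + (L - 1) = J (Suc n)" using J_less_Suc[of n] by (auto simp: L_def)
  define w where "w = z / of_real (R n)"
  define x where "x = norm z / R n"
  note pos = R_pos[of n] R_pos[of "Suc n"] vR_pos[of n] vR_pos[of "Suc n"] v_pos[of "norm z", simplified]
  have x: "norm w = x" "0 \<le> x" using pos by (auto simp: w_def x_def norm_divide)
  have "(\<Sum>m\<in>{J n<..J (Suc n)}. block_coeffs q m * z ^ m) =
      w ^ Suc (J n) / of_real (v (R n)) * (\<Sum>i<L. q n i * w ^ i)"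
    unfolding sum_block_shift sum_distrib_left L_def[symmetric]
  proof (intro sum.cong refl)
    fix i assume "i \<in> {..<L}"
    then have "block_coeffs q (Suc (J n) + i) = q n i / of_real (v (R n) * R n ^ (Suc (J n) + i))"
      by (intro block_coeffs_eq) (simp add: L_def)
    then show "block_coeffs q (Suc (J n) + i) * z ^ (Suc (J n) + i) =
        w ^ Suc (J n) / of_real (v (R n)) * (q n i * w ^ i)"
      by (simp add: w_def power_divide power_add mult_ac)
  qed
  then have eq: "v (norm z) * norm (\<Sum>m\<in>{J n<..J (Suc n)}. block_coeffs q m * z ^ m) =
      v (norm z) / v (R n) * (x ^ Suc (J n) * norm (\<Sum>i<L. q n i * w ^ i))"
    using pos by (simp add: norm_mult norm_divide norm_power x)
  show "v (norm z) * norm (\<Sum>m\<in>{J n<..J (Suc n)}. block_coeffs q m * z ^ m) \<le> E n (norm z)"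
    if "norm z \<le> R n"
  proof -
    have "x \<le> 1" using that pos by (simp add: x_def)
    then have "norm (\<Sum>i<L. q n i * w ^ i) \<le> 1"
      using norm_poly_sum_le_inside[of "q n" L w] q x by (simp add: L_def)
    then have "x ^ Suc (J n) * norm (\<Sum>i<L. q n i * w ^ i) \<le> x ^ J n * 1"
      using \<open>x \<le> 1\<close> x by (intro mult_mono power_decreasing) auto
    then have "v (norm z) / v (R n) * (x ^ Suc (J n) * norm (\<Sum>i<L. q n i * w ^ i)) \<le> v (norm z) / v (R n) * x ^ J n"
      using pos by (intro mult_left_mono) auto
    then show ?thesis unfolding eq by (simp add: E_def x_def)
  qed
  show "v (norm z) * norm (\<Sum>m\<in>{J n<..J (Suc n)}. block_coeffs q m * z ^ m) \<le> K * E (Suc n) (norm z)"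
    if "R n \<le> norm z"
  proof -
    have "1 \<le> x" using that pos by (simp add: x_def)
    then have "norm (\<Sum>i<L. q n i * w ^ i) \<le> x ^ (L - 1)"
      using norm_poly_sum_le_outside[of "q n" L w] q x by (simp add: L_def)
    then have "x ^ Suc (J n) * norm (\<Sum>i<L. q n i * w ^ i) \<le> x ^ Suc (J n) * x ^ (L - 1)"
      using x by (intro mult_left_mono) auto
    also have "\<dots> = x ^ J (Suc n)" unfolding power_add[symmetric] L(2) ..
    finally have "v (norm z) / v (R n) * (x ^ Suc (J n) * norm (\<Sum>i<L. q n i * w ^ i)) \<le> v (norm z) / v (R n) * x ^ J (Suc n)"
      using pos by (intro mult_left_mono) auto
    also have "\<dots> = (R (Suc n) / R n) ^ J (Suc n) * (v (R (Suc n)) / v (R n)) * E (Suc n) (norm z)"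
      using pos by (simp add: E_def x_def power_divide)
    also have "\<dots> \<le> K * E (Suc n) (norm z)"
      by (intro mult_right_mono B_le' E_nonneg) auto
    finally show ?thesis unfolding eq .
  qed
qed

lemma sum_norm_block_poly_le:
  assumes q: "\<And>n z. norm z = 1 \<Longrightarrow> norm (\<Sum>i<J (Suc n) - J n. q n i * z ^ i) \<le> 1"
  shows "(\<Sum>n<N. v (norm z) * norm (\<Sum>m\<in>{J n<..J (Suc n)}. block_coeffs q m * z ^ m))
     \<le> (K * b + 1) * (1 / (1 - 1 / b))"
proof -
  define P where "P n = v (norm z) * norm (\<Sum>m\<in>{J n<..J (Suc n)}. block_coeffs q m * z ^ m)" for n
  have P0: "0 \<le> P n" for n using v_pos[of "norm z"] by (simp add: P_def)
  define k where "k = (LEAST k. norm z \<le> R k)"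
  have k: "norm z \<le> R k" unfolding k_def using R_unbounded by (rule LeastI_ex)
  have below: "R n \<le> norm z" if "n < k" for n
    using not_less_Least[of n "\<lambda>k. norm z \<le> R k"] that by (simp add: k_def[symmetric])
  define c where "c = 1 / b"
  have c: "0 < c" "c < 1" using b by (auto simp: c_def)
  have geo: "(\<Sum>i<n. c ^ i) \<le> 1 / (1 - c)" for n
    using c by (simp add: sum_gp_strict divide_right_mono)
  \<comment> \<open>For these blocks only \<open>R (k - 1) \<le> norm z\<close> is known, so the
    decay starts one step late; the factor \<open>b\<close> makes up for it. At
    \<open>Suc n = k\<close> the trivial bound 1 is used.\<close>
  have small: "P n \<le> K * b * c ^ (k - Suc n)" if "n < k" for n
  proof -
    have "E (Suc n) (norm z) \<le> b * c ^ (k - Suc n)"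
    proof (cases "Suc n = k")
      case True
      then show ?thesis using E_le_1[of "norm z" k] b by simp
    next
      case False
      with that have "E (Suc n) (norm z) \<le> (1 / b) ^ (k - 1 - Suc n)"
        by (intro E_decay_below below) auto
      also have "\<dots> = b * c ^ (Suc (k - 1 - Suc n))" using b by (simp add: c_def)
      also have "Suc (k - 1 - Suc n) = k - Suc n" using that False by simp
      finally show ?thesis .
    qed
    then have "K * E (Suc n) (norm z) \<le> K * (b * c ^ (k - Suc n))"
      using K_pos by (intro mult_left_mono) auto
    then show ?thesis
      using norm_block_poly_le(2)[OF q below[OF that]] by (simp add: P_def mult.assoc)
  qed
  have large: "P n \<le> c ^ (n - k)" if "k \<le> n" for n
  proof -
    have "norm z \<le> R n" using k R_mono[OF that] by linarith
    then have "P n \<le> E n (norm z)" unfolding P_def by (intro norm_block_poly_le(1) q)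
    also have "\<dots> \<le> c ^ (n - k)" unfolding c_def using k that by (intro E_decay_above) auto
    finally show ?thesis .
  qed
  have "(\<Sum>n<N. P n) \<le> (\<Sum>n\<in>{..<k} \<union> {k..<k+N}. P n)"
    by (intro sum_mono2) (auto simp: P0)
  also have "\<dots> = (\<Sum>n<k. P n) + (\<Sum>n\<in>{k..<k+N}. P n)"
    by (rule sum.union_disjoint) auto
  also have "\<dots> \<le> (\<Sum>n<k. K * b * c ^ (k - Suc n)) + (\<Sum>n\<in>{k..<k+N}. c ^ (n - k))"
    by (intro add_mono sum_mono small large) auto
  also have "(\<Sum>n<k. K * b * c ^ (k - Suc n)) = K * b * (\<Sum>i<k. c ^ i)"
    by (simp add: sum.nat_diff_reindex[of "\<lambda>i. c ^ i"] flip: sum_distrib_left)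
  also have "(\<Sum>n\<in>{k..<k+N}. c ^ (n - k)) = (\<Sum>i<N. c ^ i)"
    by (rule sum.reindex_bij_witness[of _ "\<lambda>i. k + i" "\<lambda>n. n - k"]) auto
  also have "K * b * (\<Sum>i<k. c ^ i) + (\<Sum>i<N. c ^ i) \<le> K * b * (1 / (1 - c)) + 1 / (1 - c)"
    using K_pos b by (intro add_mono mult_left_mono geo) auto
  also have "\<dots> = (K * b + 1) * (1 / (1 - 1 / b))" by (simp add: c_def add_divide_distrib)
  finally show ?thesis by (simp add: P_def)
qed

lemma summable_block_coeffs:
  assumes q: "\<And>n z. norm z = 1 \<Longrightarrow> norm (\<Sum>i<J (Suc n) - J n. q n i * z ^ i) \<le> 1"
  shows "summable (\<lambda>m. block_coeffs q m * z ^ m)"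
proof -
  \<comment> \<open>Bounding the coefficients at twice the radius yields the geometric factor
    \<open>(1 / 2) ^ m\<close>. Once \<open>r \<le> R n\<close>, maximality at \<open>R n\<close>
    absorbs everything else into \<open>1 / v r\<close>.\<close>
  define r where "r = 2 * norm z"
  have r: "0 \<le> r" by (simp add: r_def)
  obtain k where k: "r \<le> R k" using R_unbounded by blast
  have "norm (block_coeffs q m * z ^ m) \<le> 1 / v r * (1 / 2) ^ m" if m: "Suc (J k) \<le> m" for m
  proof -
    obtain n where n: "k \<le> n" "m \<in> {J n<..J (Suc n)}"
      using block_exists[of k m] m by auto
    define i where "i = m - Suc (J n)"
    have i: "i < J (Suc n) - J n" "m = Suc (J n) + i" using n(2) by (auto simp: i_def)
    note pos = R_pos[of n] vR_pos[of n] v_pos[OF r]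
    have "(norm (q n i))\<^sup>2 \<le> (\<Sum>i<J (Suc n) - J n. (norm (q n i))\<^sup>2)"
      using i(1) by (intro member_le_sum) auto
    also have "\<dots> \<le> 1\<^sup>2" by (intro sum_norm_power2_le_of_circle_bound q)
    finally have q1: "norm (q n i) \<le> 1" by (simp add: abs_square_le_1)
    have rn: "r \<le> R n" using k R_mono[OF n(1)] by linarith
    have nz: "norm z = r / 2" by (simp add: r_def)
    have "norm (block_coeffs q m * z ^ m) = norm (q n i) * ((r / R n) ^ m / v (R n) * (1 / 2) ^ m)"
      unfolding i(2) block_coeffs_eq[OF i(1)] norm_mult norm_divide norm_power nz norm_of_real
      using pos by (simp add: power_divide)
    also have "\<dots> \<le> 1 * ((r / R n) ^ J n / v (R n) * (1 / 2) ^ m)"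
      using q1 pos r rn i by (intro mult_mono divide_right_mono power_decreasing) auto
    also have "(r / R n) ^ J n / v (R n) = E n r / v r"
      using pos by (simp add: E_def)
    also have "1 * (E n r / v r * (1 / 2) ^ m) \<le> 1 / v r * (1 / 2) ^ m"
      using pos E_le_1[OF r, of n] by (auto intro!: mult_right_mono divide_right_mono)
    finally show ?thesis .
  qed
  then show ?thesis
    by (rule summable_comparison_test'[rotated]) (auto intro!: summable_mult summable_geometric)
qed

lemma block_coeffs_in_H_inf_seq:
  assumes q: "\<And>n z. norm z = 1 \<Longrightarrow> norm (\<Sum>i<J (Suc n) - J n. q n i * z ^ i) \<le> 1"
  shows "block_coeffs q \<in> H_inf_seq v"
proof -
  define f where "f z = (\<Sum>m. block_coeffs q m * z ^ m)" for z
  have sums: "(\<lambda>m. block_coeffs q m * z ^ m) sums f z" for z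
    unfolding f_def using summable_block_coeffs[OF q] by (rule summable_sums)
  have "f holomorphic_on ball 0 r" for r
    by (rule power_series_holomorphic[of _ _ "block_coeffs q"]) (use sums in simp)
  then have "f analytic_on (\<Union>r. ball 0 r)"
    unfolding analytic_on_UN by (simp add: analytic_on_open)
  moreover have "(\<Union>r. ball 0 r) = (UNIV :: complex set)"
    by (auto intro: gt_ex)
  ultimately have hol: "f holomorphic_on UNIV"
    by (metis analytic_imp_holomorphic)
  define C where "C = (K * b + 1) * (1 / (1 - 1 / b))"
  have bound: "v (norm z) * norm (f z) \<le> C" for z
  proof (rule Lim_bounded)
    \<comment> \<open>Along this subsequence the partial sums consist of complete blocks, so the
      uniform bound applies to them.\<close>
    have sub: "strict_mono (\<lambda>N. Suc (J N))"
      using strict_mono by (simp add: strict_mono_def)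
    have "(\<lambda>N. \<Sum>m<N. block_coeffs q m * z ^ m) \<longlonglongrightarrow> f z"
      using sums by (simp add: sums_def)
    from LIMSEQ_subseq_LIMSEQ[OF this sub]
    show "(\<lambda>N. v (norm z) * norm (\<Sum>m<Suc (J N). block_coeffs q m * z ^ m)) \<longlonglongrightarrow> v (norm z) * norm (f z)"
      by (auto simp: o_def intro!: tendsto_intros)
    show "\<forall>N\<ge>0. v (norm z) * norm (\<Sum>m<Suc (J N). block_coeffs q m * z ^ m) \<le> C"
    proof (intro allI impI)
      fix N
      have "(\<Sum>m<Suc (J N). block_coeffs q m * z ^ m) = (\<Sum>m\<in>{J 0<..J N}. block_coeffs q m * z ^ m)"
        by (intro sum.mono_neutral_right) (auto simp: block_coeffs_def)
      also have "\<dots> = (\<Sum>n<N. \<Sum>m\<in>{J n<..J (Suc n)}. block_coeffs q m * z ^ m)"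
        by (rule sum_blocks[symmetric])
      also have "norm \<dots> \<le> (\<Sum>n<N. norm (\<Sum>m\<in>{J n<..J (Suc n)}. block_coeffs q m * z ^ m))"
        by (rule norm_sum)
      finally have "v (norm z) * norm (\<Sum>m<Suc (J N). block_coeffs q m * z ^ m) \<le>
          v (norm z) * (\<Sum>n<N. norm (\<Sum>m\<in>{J n<..J (Suc n)}. block_coeffs q m * z ^ m))"
        using v_pos[of "norm z"] by (intro mult_left_mono) auto
      also have "\<dots> \<le> C"
        unfolding sum_distrib_left C_def by (rule sum_norm_block_poly_le[OF q])
      finally show "v (norm z) * norm (\<Sum>m<Suc (J N). block_coeffs q m * z ^ m) \<le> C" .
    qed
  qed
  then have "f \<in> H_inf v"
    using hol by (auto simp: H_inf_def bdd_above_def)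
  then show ?thesis using sums by (auto simp: H_inf_seq_def)
qed

end

subsection \<open>Multipliers\<close>

lemma block_norm_nonneg:
  assumes "J n < J (Suc n)"
  shows "0 \<le> block_norm J r \<mu> n"
proof (cases "r = \<infinity>")
  case True
  have "0 \<le> \<bar>\<mu> (J (Suc n))\<bar>" by simp
  also have "\<dots> \<le> Max ((\<lambda>m. \<bar>\<mu> m\<bar>) ` {J n<..J (Suc n)})"
    using assms by (intro Max_ge) auto
  finally show ?thesis using True by (simp add: block_norm_def)
qed (simp add: block_norm_def)

lemma norm_single_power_sum_le:
  "norm z = 1 \<Longrightarrow> norm (\<Sum>i<L. (if i = j then 1 else 0) * z ^ i :: complex) \<le> 1"
  by (simp add: if_distrib[of "\<lambda>x. x * _"] norm_power cong: if_cong)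

context weight_blocks
begin

section \<open>From blockwise estimates to multipliers\<close>

lemma summable_blocks_iff:
  fixes g :: "nat \<Rightarrow> real"
  assumes g: "\<And>m. 0 \<le> g m"
  shows "summable (\<lambda>n. \<Sum>m\<in>{J n<..J (Suc n)}. g m) \<longleftrightarrow> summable g"
proof
  assume *: "summable (\<lambda>n. \<Sum>m\<in>{J n<..J (Suc n)}. g m)"
  show "summable g"
  proof (rule summableI_nonneg_bounded[OF g])
    fix M
    have "(\<Sum>m<M. g m) \<le> (\<Sum>m\<in>{..J 0} \<union> {J 0<..J M}. g m)"
      using le_J[of M] by (intro sum_mono2) (auto simp: g)
    also have "\<dots> = (\<Sum>m\<le>J 0. g m) + (\<Sum>n<M. \<Sum>m\<in>{J n<..J (Suc n)}. g m)"
      unfolding sum_blocks by (rule sum.union_disjoint) auto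
    also have "\<dots> \<le> (\<Sum>m\<le>J 0. g m) + (\<Sum>n. \<Sum>m\<in>{J n<..J (Suc n)}. g m)"
      using * by (intro add_left_mono sum_le_suminf) (auto intro: sum_nonneg g)
    finally show "(\<Sum>m<M. g m) \<le> (\<Sum>m\<le>J 0. g m) + (\<Sum>n. \<Sum>m\<in>{J n<..J (Suc n)}. g m)" .
  qed
next
  assume *: "summable g"
  show "summable (\<lambda>n. \<Sum>m\<in>{J n<..J (Suc n)}. g m)"
  proof (rule summableI_nonneg_bounded)
    fix N
    show "(\<Sum>n<N. \<Sum>m\<in>{J n<..J (Suc n)}. g m) \<le> suminf g"
      unfolding sum_blocks using * g by (intro sum_le_suminf) auto
  qed (auto intro: sum_nonneg g)
qed

text \<open>Parseval at the radius \<open>R n\<close> bounds the square sum over the n-th block: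
  this embeds the function space into a weighted copy of \<ell>^J(2, \<infinity>). The weights are
  those divided out in \<open>weighted_coeffs\<close>, so the product with \<open>lam\<close> is
  unchanged.\<close>

lemma normalized_coeffs:
  assumes "a \<in> H_inf_seq v"
  obtains M \<alpha> where "0 < M" "\<And>m. 0 \<le> \<alpha> m" "\<And>n. (\<Sum>m\<in>{J n<..J (Suc n)}. (\<alpha> m)\<^sup>2) \<le> M\<^sup>2"
    "\<And>lam m. J 0 < m \<Longrightarrow> norm (lam m * a m) = weighted_coeffs v \<rho> J lam m * \<alpha> m"
proof -
  obtain M where M: "0 < M"
    "\<And>r I. 0 \<le> r \<Longrightarrow> finite I \<Longrightarrow> (\<Sum>m\<in>I. (v r * r ^ m * norm (a m))\<^sup>2) \<le> M\<^sup>2"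
    using H_inf_seq_Parseval[OF v_pos assms] by blast
  define \<alpha> where "\<alpha> m = (let n = block_index J m in v (R n) * R n ^ m * norm (a m))" for m
  have \<alpha>: "\<alpha> m = v (R n) * R n ^ m * norm (a m)" if "m \<in> {J n<..J (Suc n)}" for m n
    using block_index_eq[OF that] by (simp add: \<alpha>_def)
  have "0 \<le> \<alpha> m" for m
    using R_pos[of "block_index J m"] vR_pos[of "block_index J m"] by (simp add: \<alpha>_def Let_def)
  moreover have "(\<Sum>m\<in>{J n<..J (Suc n)}. (\<alpha> m)\<^sup>2) \<le> M\<^sup>2" for n
    using M(2)[of "R n" "{J n<..J (Suc n)}"] R_pos[of n] by (simp add: \<alpha>[of _ n])
  moreover have "norm (lam m * a m) = weighted_coeffs v \<rho> J lam m * \<alpha> m" if "J 0 < m" for lam m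
  proof -
    from block_exists[OF that] obtain n where n: "m \<in> {J n<..J (Suc n)}" by blast
    then show ?thesis
      using R_pos[of n] vR_pos[of n] by (simp add: weighted_coeffs_eq[OF n] \<alpha>[OF n] norm_mult)
  qed
  ultimately show ?thesis using M(1) that by blast
qed

text \<open>Sufficiency reduces to the Hoelder type estimate \<open>le\<close> on a single block,
  since \<alpha> has uniformly bounded square sums over the blocks.\<close>

lemma multiplier_of_ell_J:
  fixes p :: real and lam :: "nat \<Rightarrow> complex"
  defines "\<mu> \<equiv> weighted_coeffs v \<rho> J lam"
  assumes mem: "\<mu> \<in> ell_J J r (ereal p)"
    and le: "\<And>n \<alpha> M. (\<And>m. 0 \<le> \<alpha> m) \<Longrightarrow> 0 < M \<Longrightarrow> (\<Sum>m\<in>{J n<..J (Suc n)}. (\<alpha> m)\<^sup>2) \<le> M\<^sup>2 \<Longrightarrow>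
      (\<Sum>m\<in>{J n<..J (Suc n)}. (\<mu> m * \<alpha> m) powr p) \<le> block_norm J r \<mu> n powr p * M powr p"
  shows "multiplier lam (H_inf_seq v) (ell (ereal p))"
  unfolding multiplier_def
proof
  fix a assume "a \<in> H_inf_seq v"
  then obtain M \<alpha> where M: "0 < M" "\<And>m. 0 \<le> \<alpha> m"
    "\<And>n. (\<Sum>m\<in>{J n<..J (Suc n)}. (\<alpha> m)\<^sup>2) \<le> M\<^sup>2"
    and eq: "\<And>m. J 0 < m \<Longrightarrow> norm (lam m * a m) = \<mu> m * \<alpha> m"
    unfolding \<mu>_def by (rule normalized_coeffs) blast
  have block: "(\<Sum>m\<in>{J n<..J (Suc n)}. norm (lam m * a m) powr p) \<le> block_norm J r \<mu> n powr p * M powr p" for n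
  proof -
    have "(\<Sum>m\<in>{J n<..J (Suc n)}. norm (lam m * a m) powr p) = (\<Sum>m\<in>{J n<..J (Suc n)}. (\<mu> m * \<alpha> m) powr p)"
    proof (intro sum.cong refl)
      fix m assume "m \<in> {J n<..J (Suc n)}"
      then have "J 0 < m" using J_mono[of 0 n] by simp
      then show "norm (lam m * a m) powr p = (\<mu> m * \<alpha> m) powr p" by (simp only: eq)
    qed
    then show ?thesis using le[OF M(2,1,3), of n] by simp
  qed
  have "summable (\<lambda>n. block_norm J r \<mu> n powr p)"
    using mem block_norm_nonneg[of J, OF J_less_Suc] by (simp add: ell_J_def ell_def)
  then have "summable (\<lambda>n. block_norm J r \<mu> n powr p * M powr p)" by (rule summable_mult2)
  then have "summable (\<lambda>n. \<Sum>m\<in>{J n<..J (Suc n)}. norm (lam m * a m) powr p)"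
    by (rule summable_comparison_test'[where N = 0]) (use block in \<open>simp add: sum_nonneg\<close>)
  then show "(\<lambda>m. lam m * a m) \<in> ell (ereal p)"
    by (subst (asm) summable_blocks_iff) (auto simp: ell_def)
qed

text \<open>Necessity reduces to finding, on each block separately, a bounded polynomial that is
  extremal up to a constant \<open>c\<close> independent of the block. All of them are glued into a
  single test function.\<close>

lemma ell_J_of_multiplier:
  fixes p c :: real and lam :: "nat \<Rightarrow> complex"
  defines "\<mu> \<equiv> weighted_coeffs v \<rho> J lam"
  assumes mult: "multiplier lam (H_inf_seq v) (ell (ereal p))" and "0 < c"
    and ex: "\<And>n. \<exists>q :: nat \<Rightarrow> complex.
      (\<forall>z. norm z = 1 \<longrightarrow> norm (\<Sum>i<J (Suc n) - J n. q i * z ^ i) \<le> 1) \<and>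
      c * block_norm J r \<mu> n powr p \<le> (\<Sum>i<J (Suc n) - J n. (\<mu> (Suc (J n) + i) * norm (q i)) powr p)"
  shows "\<mu> \<in> ell_J J r (ereal p)"
proof -
  have "\<exists>q. \<forall>n. (\<forall>z. norm z = 1 \<longrightarrow> norm (\<Sum>i<J (Suc n) - J n. q n i * z ^ i :: complex) \<le> 1) \<and>
      c * block_norm J r \<mu> n powr p \<le> (\<Sum>i<J (Suc n) - J n. (\<mu> (Suc (J n) + i) * norm (q n i)) powr p)"
    by (intro choice allI ex)
  then obtain q :: "nat \<Rightarrow> nat \<Rightarrow> complex" where
    q: "\<And>n z. norm z = 1 \<Longrightarrow> norm (\<Sum>i<J (Suc n) - J n. q n i * z ^ i) \<le> 1" and
    le: "\<And>n. c * block_norm J r \<mu> n powr p \<le> (\<Sum>i<J (Suc n) - J n. (\<mu> (Suc (J n) + i) * norm (q n i)) powr p)"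
    by auto
  define g where "g m = norm (lam m * block_coeffs q m) powr p" for m
  have "summable g"
    using mult block_coeffs_in_H_inf_seq[OF q] by (simp add: multiplier_def ell_def g_def[abs_def])
  then have "summable (\<lambda>n. \<Sum>m\<in>{J n<..J (Suc n)}. g m)"
    by (subst summable_blocks_iff) (auto simp: g_def)
  then have "summable (\<lambda>n. c * block_norm J r \<mu> n powr p)"
  proof (rule summable_comparison_test'[where N = 0])
    fix n
    have "(\<Sum>m\<in>{J n<..J (Suc n)}. g m) =
        (\<Sum>i<J (Suc n) - J n. (\<mu> (Suc (J n) + i) * norm (q n i)) powr p)"
      unfolding sum_block_shift g_def \<mu>_def
      by (intro sum.cong refl) (simp only: norm_mult_block_coeffs lessThan_iff)
    then show "norm (c * block_norm J r \<mu> n powr p) \<le> (\<Sum>m\<in>{J n<..J (Suc n)}. g m)"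
      using le[of n] \<open>0 < c\<close> by simp
  qed
  then have "summable (\<lambda>n. block_norm J r \<mu> n powr p)"
    using \<open>0 < c\<close> by (simp add: summable_cmult_iff)
  then show ?thesis
    using block_norm_nonneg[of J, OF J_less_Suc] by (simp add: ell_J_def ell_def)
qed

section \<open>The three ranges of the exponent\<close>

theorem multiplier_iff_small:
  fixes p :: real
  assumes "1 \<le> p" "p < 2" and r: "r = 2 * p / (2 - p)"
  shows "multiplier lam (H_inf_seq v) (ell (ereal p)) \<longleftrightarrow> weighted_coeffs v \<rho> J lam \<in> ell_J J (ereal r) (ereal p)"
proof -
  define \<mu> where "\<mu> = weighted_coeffs v \<rho> J lam"
  have \<mu>: "0 \<le> \<mu> m" for m by (simp add: \<mu>_def weighted_coeffs_nonneg)
  have bn: "block_norm J (ereal r) \<mu> n powr p = (\<Sum>m\<in>{J n<..J (Suc n)}. \<mu> m powr r) powr (p / r)" for n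
    using \<mu> by (simp add: block_norm_def powr_powr)
  show ?thesis
  proof
    assume "multiplier lam (H_inf_seq v) (ell (ereal p))"
    then show "weighted_coeffs v \<rho> J lam \<in> ell_J J (ereal r) (ereal p)"
    proof (rule ell_J_of_multiplier[where c = "(1 / 96) powr p"], unfold \<mu>_def[symmetric])
      show "\<exists>q :: nat \<Rightarrow> complex.
        (\<forall>z. norm z = 1 \<longrightarrow> norm (\<Sum>i<J (Suc n) - J n. q i * z ^ i) \<le> 1) \<and>
        (1 / 96) powr p * block_norm J (ereal r) \<mu> n powr p
          \<le> (\<Sum>i<J (Suc n) - J n. (\<mu> (Suc (J n) + i) * norm (q i)) powr p)" for n
        unfolding bn sum_block_shift
        using J_less_Suc[of n] assms \<mu> by (intro exists_short_poly_large_coeffs_powr) auto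
    qed simp
  next
    assume "weighted_coeffs v \<rho> J lam \<in> ell_J J (ereal r) (ereal p)"
    then show "multiplier lam (H_inf_seq v) (ell (ereal p))"
    proof (rule multiplier_of_ell_J, unfold \<mu>_def[symmetric])
      fix n M and \<alpha> :: "nat \<Rightarrow> real"
      assume "\<And>m. 0 \<le> \<alpha> m" "0 < M" "(\<Sum>m\<in>{J n<..J (Suc n)}. (\<alpha> m)\<^sup>2) \<le> M\<^sup>2"
      then show "(\<Sum>m\<in>{J n<..J (Suc n)}. (\<mu> m * \<alpha> m) powr p) \<le> block_norm J (ereal r) \<mu> n powr p * M powr p"
        unfolding bn using assms \<mu> by (intro sum_powr_mult_le_small_exponent) auto
    qed
  qed
qed

lemma block_norm_infinity_attained:
  assumes \<mu>: "\<And>m. 0 \<le> \<mu> m"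
  obtains j where "j < J (Suc n) - J n" "block_norm J \<infinity> \<mu> n = \<mu> (Suc (J n) + j)"
proof -
  have "Max ((\<lambda>m. \<bar>\<mu> m\<bar>) ` {J n<..J (Suc n)}) \<in> (\<lambda>m. \<bar>\<mu> m\<bar>) ` {J n<..J (Suc n)}"
    using J_less_Suc[of n] by (intro Max_in) auto
  then obtain m where "m \<in> {J n<..J (Suc n)}" "block_norm J \<infinity> \<mu> n = \<mu> m"
    using \<mu> by (auto simp: block_norm_def)
  then show ?thesis by (intro that[of "m - Suc (J n)"]) auto
qed

lemma le_block_norm_infinity:
  assumes "m \<in> {J n<..J (Suc n)}"
  shows "\<mu> m \<le> block_norm J \<infinity> \<mu> n"
proof -
  have "\<mu> m \<le> \<bar>\<mu> m\<bar>" by simp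
  also have "\<dots> \<le> Max ((\<lambda>m. \<bar>\<mu> m\<bar>) ` {J n<..J (Suc n)})"
    using assms by (intro Max_ge imageI) auto
  finally show ?thesis by (simp add: block_norm_def)
qed

theorem multiplier_iff_large:
  fixes p :: real
  assumes "2 \<le> p"
  shows "multiplier lam (H_inf_seq v) (ell (ereal p)) \<longleftrightarrow> weighted_coeffs v \<rho> J lam \<in> ell_J J \<infinity> (ereal p)"
proof -
  define \<mu> where "\<mu> = weighted_coeffs v \<rho> J lam"
  have \<mu>: "0 \<le> \<mu> m" for m by (simp add: \<mu>_def weighted_coeffs_nonneg)
  show ?thesis
  proof
    assume "multiplier lam (H_inf_seq v) (ell (ereal p))"
    then show "weighted_coeffs v \<rho> J lam \<in> ell_J J \<infinity> (ereal p)"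
    proof (rule ell_J_of_multiplier[where c = 1], unfold \<mu>_def[symmetric])
      fix n
      obtain j where j: "j < J (Suc n) - J n" "block_norm J \<infinity> \<mu> n = \<mu> (Suc (J n) + j)"
        by (rule block_norm_infinity_attained[of \<mu> n, OF \<mu>])
      \<comment> \<open>A single monomial at an index where \<mu> attains its block maximum already
        realizes the block norm.\<close>
      define q :: "nat \<Rightarrow> complex" where "q i = (if i = j then 1 else 0)" for i
      have "1 * block_norm J \<infinity> \<mu> n powr p = (\<mu> (Suc (J n) + j) * norm (q j)) powr p"
        using j(2) by (simp add: q_def)
      also have "\<dots> \<le> (\<Sum>i<J (Suc n) - J n. (\<mu> (Suc (J n) + i) * norm (q i)) powr p)"
        using j(1) by (intro member_le_sum) auto
      finally have *: "1 * block_norm J \<infinity> \<mu> n powr p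
          \<le> (\<Sum>i<J (Suc n) - J n. (\<mu> (Suc (J n) + i) * norm (q i)) powr p)" .
      show "\<exists>q :: nat \<Rightarrow> complex.
        (\<forall>z. norm z = 1 \<longrightarrow> norm (\<Sum>i<J (Suc n) - J n. q i * z ^ i) \<le> 1) \<and>
        1 * block_norm J \<infinity> \<mu> n powr p
          \<le> (\<Sum>i<J (Suc n) - J n. (\<mu> (Suc (J n) + i) * norm (q i)) powr p)"
        by (intro exI[of _ q] conjI allI impI *) (unfold q_def, rule norm_single_power_sum_le)
    qed simp
  next
    assume "weighted_coeffs v \<rho> J lam \<in> ell_J J \<infinity> (ereal p)"
    then show "multiplier lam (H_inf_seq v) (ell (ereal p))"
    proof (rule multiplier_of_ell_J, unfold \<mu>_def[symmetric])
      fix n M and \<alpha> :: "nat \<Rightarrow> real"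
      assume "\<And>m. 0 \<le> \<alpha> m" "0 < M" "(\<Sum>m\<in>{J n<..J (Suc n)}. (\<alpha> m)\<^sup>2) \<le> M\<^sup>2"
      then show "(\<Sum>m\<in>{J n<..J (Suc n)}. (\<mu> m * \<alpha> m) powr p) \<le> block_norm J \<infinity> \<mu> n powr p * M powr p"
        using assms \<mu> by (intro sum_powr_mult_le_large_exponent) (auto intro: le_block_norm_infinity)
    qed
  qed
qed

theorem multiplier_iff_infinity:
  "multiplier lam (H_inf_seq v) (ell \<infinity>) \<longleftrightarrow> weighted_coeffs v \<rho> J lam \<in> ell_J J \<infinity> \<infinity>"
proof -
  define \<mu> where "\<mu> = weighted_coeffs v \<rho> J lam"
  have \<mu>: "0 \<le> \<mu> m" for m by (simp add: \<mu>_def weighted_coeffs_nonneg)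
  show ?thesis
  proof
    assume mult: "multiplier lam (H_inf_seq v) (ell \<infinity>)"
    have "\<exists>j<J (Suc n) - J n. block_norm J \<infinity> \<mu> n = \<mu> (Suc (J n) + j)" for n
      by (rule block_norm_infinity_attained[of \<mu> n, OF \<mu>]) blast
    then obtain j where j: "\<And>n. j n < J (Suc n) - J n" "\<And>n. block_norm J \<infinity> \<mu> n = \<mu> (Suc (J n) + j n)"
      by metis
    define q :: "nat \<Rightarrow> nat \<Rightarrow> complex" where "q n i = (if i = j n then 1 else 0)" for n i
    \<comment> \<open>One function carries the extremal monomials of all blocks, so a single bound
      \<open>C\<close> controls every block norm.\<close>
    have "block_coeffs q \<in> H_inf_seq v"
      unfolding q_def by (intro block_coeffs_in_H_inf_seq norm_single_power_sum_le)
    with mult obtain C where C: "\<And>m. norm (lam m * block_coeffs q m) \<le> C"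
      unfolding multiplier_def ell_def by (auto simp: bounded_iff)
    have "norm (block_norm J \<infinity> \<mu> n) \<le> C" for n
    proof -
      have "norm (lam (Suc (J n) + j n) * block_coeffs q (Suc (J n) + j n)) = \<mu> (Suc (J n) + j n)"
        unfolding norm_mult_block_coeffs[OF j(1)] by (simp add: q_def \<mu>_def)
      then show ?thesis
        using C[of "Suc (J n) + j n"] \<mu>[of "Suc (J n) + j n"] by (simp only: j(2) real_norm_def abs_of_nonneg)
    qed
    then show "weighted_coeffs v \<rho> J lam \<in> ell_J J \<infinity> \<infinity>"
      by (auto simp: ell_J_def ell_def bounded_iff \<mu>_def)
  next
    assume "weighted_coeffs v \<rho> J lam \<in> ell_J J \<infinity> \<infinity>"
    then obtain C where C: "\<And>n. norm (block_norm J \<infinity> \<mu> n) \<le> C"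
      by (auto simp: ell_J_def ell_def bounded_iff \<mu>_def)
    show "multiplier lam (H_inf_seq v) (ell \<infinity>)"
      unfolding multiplier_def
    proof
      fix a assume "a \<in> H_inf_seq v"
      then obtain M \<alpha> where M: "0 < M" "\<And>m. 0 \<le> \<alpha> m"
        "\<And>n. (\<Sum>m\<in>{J n<..J (Suc n)}. (\<alpha> m)\<^sup>2) \<le> M\<^sup>2"
        and eq: "\<And>m. J 0 < m \<Longrightarrow> norm (lam m * a m) = \<mu> m * \<alpha> m"
        unfolding \<mu>_def by (rule normalized_coeffs) blast
      \<comment> \<open>The added finite sum takes care of the indices up to \<open>J 0\<close>, on
        which \<mu> gives no control.\<close>
      have "norm (lam m * a m) \<le> C * M + (\<Sum>m\<le>J 0. norm (lam m * a m))" for m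
      proof (cases "J 0 < m")
        case True
        from block_exists[OF this] obtain n where n: "m \<in> {J n<..J (Suc n)}" by blast
        have "(\<alpha> m)\<^sup>2 \<le> (\<Sum>m\<in>{J n<..J (Suc n)}. (\<alpha> m)\<^sup>2)"
          using n by (intro member_le_sum) auto
        also note M(3)
        finally have "\<alpha> m \<le> M" by (rule power2_le_imp_le) (use M(1) in simp)
        moreover have "\<mu> m \<le> C"
          using le_block_norm_infinity[OF n, of \<mu>] C[of n] by simp
        ultimately have "\<mu> m * \<alpha> m \<le> C * M"
          using \<mu>[of m] M(2)[of m] by (intro mult_mono) linarith+
        then show ?thesis using eq[OF True] by (simp add: add_increasing2 sum_nonneg)
      next
        case False
        then have "norm (lam m * a m) \<le> (\<Sum>m\<le>J 0. norm (lam m * a m))"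
          by (intro member_le_sum) auto
        moreover have "0 \<le> C * M"
          using M(1) order_trans[OF norm_ge_zero C[of 0]] by simp
        ultimately show ?thesis by linarith
      qed
      then show "(\<lambda>m. lam m * a m) \<in> ell \<infinity>"
        by (auto simp: ell_def bounded_iff)
    qed
  qed
qed

end

theorem theorem4p2:
  fixes v \<rho> :: "real \<Rightarrow> real"
    and J :: "nat \<Rightarrow> nat"
    and b K :: real
    and p :: ereal
    and lam :: "nat \<Rightarrow> complex"
  assumes "weight v"
    and "max_points v \<rho>"
    and "strict_mono J"
    and "\<And>n. 0 < J n"
    and "2 < b"
    and "b \<le> K"
    and "\<And>n. b \<le> min (A v \<rho> (J n) (J (Suc n))) (B v \<rho> (J n) (J (Suc n)))"
    and "\<And>n. max (A v \<rho> (J n) (J (Suc n))) (B v \<rho> (J n) (J (Suc n))) \<le> K"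
    and "1 \<le> p"
  shows "(p < 2 \<longrightarrow>
            (multiplier lam (H_inf_seq v) (ell p) \<longleftrightarrow>
             weighted_coeffs v \<rho> J lam \<in> ell_J J (2 * p / (2 - p)) p)) \<and>
         (2 \<le> p \<and> p < \<infinity> \<longrightarrow>
            (multiplier lam (H_inf_seq v) (ell p) \<longleftrightarrow>
             weighted_coeffs v \<rho> J lam \<in> ell_J J \<infinity> p)) \<and>
         (p = \<infinity> \<longrightarrow>
            (multiplier lam (H_inf_seq v) (ell p) \<longleftrightarrow>
             weighted_coeffs v \<rho> J lam \<in> ell_J J \<infinity> \<infinity>))"
proof -
  interpret weight_blocks v \<rho> J b K
    using assms(1-5) assms(7,8) by unfold_locales auto
  show ?thesis
  proof (cases p)
    case (real p')
    have p': "1 \<le> p'" using assms(9) real by simp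
    \<comment> \<open>Below 2 the denominator is a nonzero real, so the quotient of extended reals
      is the real quotient.\<close>
    have "2 * p / (2 - p) = ereal (2 * p' / (2 - p'))" if "p' < 2"
      using that unfolding real numeral_eq_ereal by simp
    then show ?thesis
      using multiplier_iff_small[OF p' _ refl, of lam] multiplier_iff_large[of p' lam] real by auto
  qed (use multiplier_iff_infinity assms(9) in auto)
qed

end
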